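(* There is a sufficiently small constant $c>0$ such that the following holds for $\epsilon\ge d^{-c}$. (1) Let $\mathfrak{D}_g$ be the class of distributions over $\mathbb{R}^d\times\{\pm1\}$ whose marginal on $\mathbb{R}^d$ is the standard Gaussian $\mathcal{N}_d$ and which satisfy $\min_{f\in\mathcal{H}_{\mathsf{hs}}}\Pr[y\ne f(\mathbf{x})]\le\frac12-\epsilon-2\tau$ with $\tau=\epsilon$. Every statistical query (SQ) algorithm $\mathcal{A}'$ such that $$\bigl|\Pr[\mathcal{A}'(\mathcal{N}_d\times\mathrm{Unif}(\{\pm1\}))=1]-\Pr[\mathcal{A}'(\mathcal{D}_{\mathbf{x},y})=1]\bigr|\ge 1/3\quad\text{for every }\mathcal{D}_{\mathbf{x},y}\in\mathfrak{D}_g$$ either requires queries of tolerance $d^{-\Omega(1/\epsilon^2)}$ or makes $2^{d^{\Omega(1)}}$ queries. (2) Therefore, the same is true for any SQ testable learning algorithm for $\mathcal{H}_{\mathsf{hs}}$ with respect to the random classification noise oracle $\mathsf{EX}^{\mathsf{RCN}}_{\mathcal{N},1/2}$ (Gaussian marginal, noise rate $\eta_0=1/2$) that has excess error $\epsilon\ge d^{-c}$ and failure probability $\delta\le1/6$.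
   Context: $\mathcal{N}_d$ is the standard Gaussian on $\mathbb{R}^d$. $\mathcal{H}_{\mathsf{hs}}$ is the class of functions $\mathbf{x}\mapsto\mathrm{sign}(\mathbf{v}\cdot\mathbf{x})$ on $\mathbb{R}^d$, $\mathbf{v}\in\mathbb{S}^{d-1}$, with $\mathrm{sign}(t)=1$ if $t\ge0$ and $-1$ otherwise. Oracle $\mathsf{EX}^{\mathsf{RCN}}_{\mathcal{N},1/2}$: returns i.i.d. examples $(\mathbf{x},y)$ with $\mathbf{x}\sim\mathcal{N}_d$ and $y$ uniform in $\{\pm1\}$ independent of $\mathbf{x}$; i.e. the distribution $\mathcal{N}_d\times\mathrm{Unif}(\{\pm1\})$. Statistical query model: an SQ algorithm with tolerance $\tau'>0$ has access to a distribution $\mathcal{D}_{\mathbf{x},y}$ over $\mathbb{R}^d\times\{\pm1\}$ as follows: it (adaptively) makes bounded queries $q:\mathbb{R}^d\times[-1,1]\to[-1,1]$ and for each query receives a value $v\in\mathbb{R}$ with $|v-\mathbb{E}_{(\mathbf{x},y)\sim\mathcal{D}_{\mathbf{x},y}}[q(\mathbf{x},y)]|\le\tau'$. Testable learning of $\mathcal{H}$ with respect to an i.i.d. example oracle $\mathsf{EX}$, with excess error $\epsilon$ and failure probability $\delta$: the algorithm has access (here: SQ access) to some distribution $\mathcal{D}_{\mathbf{x},y}$ over $\mathbb{R}^d\times\{\pm1\}$ and outputs $\mathsf{Reject}$ or $(\mathsf{Accept},h)$ with $h:\mathbb{R}^d\to\{\pm1\}$, such that (Soundness) with probability at least $1-\delta$,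 if it accepts then $\Pr_{\mathcal{D}_{\mathbf{x},y}}[y\ne h(\mathbf{x})]\le\min_{f\in\mathcal{H}}\Pr_{\mathcal{D}_{\mathbf{x},y}}[y\ne f(\mathbf{x})]+\epsilon$; and (Completeness) if $\mathcal{D}_{\mathbf{x},y}$ is the example distribution of $\mathsf{EX}$, it accepts with probability at least $1-\delta$.
   Formalization: Upper bounds on ε are added: ε ≤ 1/6 in (1), since otherwise the class 𝔇_g is empty and the claim fails vacuously, and ε < 1/2 in (2), since for larger excess error a one-query learner outputting a constant label can succeed. *)

theory Defs
  imports "HOL-Probability.Probability"
begin

section \<open>Labelled Gaussian data and halfspaces\<close>

text \<open>
  The dimension is quantified after the absolute constants in the theorem, so \<open>\<real>\<^sup>d\<close> is rendered
  as the space of the finite product measure \<open>\<Pi>\<^sub>M i\<in>{..<d}. borel\<close>: a point is a function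
  \<^typ>\<open>nat \<Rightarrow> real\<close> that is \<^const>\<open>undefined\<close> outside \<open>{..<d}\<close>.
\<close>

type_synonym point = "nat \<Rightarrow> real"

definition Rn :: "nat \<Rightarrow> point measure" where
  "Rn d = (\<Pi>\<^sub>M i\<in>{..<d}. borel)"

definition std_gaussian :: "nat \<Rightarrow> point measure" where
  "std_gaussian d = (\<Pi>\<^sub>M i\<in>{..<d}. density lborel std_normal_density)"

definition labels :: "real set" where
  "labels = {-1, 1}"

definition distributions :: "nat \<Rightarrow> (point \<times> real) measure set" where
  "distributions d = {D. prob_space D \<and> sets D = sets (Rn d \<Otimes>\<^sub>M count_space labels)}"

text \<open>The example distribution of the random classification noise oracle with rate \<open>1/2\<close>.\<close>

definition rcn_half :: "nat \<Rightarrow> (point \<times> real) measure" where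
  "rcn_half d = std_gaussian d \<Otimes>\<^sub>M uniform_count_measure labels"

definition hypotheses :: "nat \<Rightarrow> (point \<Rightarrow> real) set" where
  "hypotheses d = Rn d \<rightarrow>\<^sub>M count_space labels"

definition sign_pm :: "real \<Rightarrow> real" where
  "sign_pm t = (if t \<ge> 0 then 1 else -1)"

definition unit_sphere :: "nat \<Rightarrow> point set" where
  "unit_sphere d = {v \<in> space (Rn d). (\<Sum>i<d. (v i)\<^sup>2) = 1}"

definition halfspaces :: "nat \<Rightarrow> (point \<Rightarrow> real) set" where
  "halfspaces d = (\<lambda>v x. sign_pm (\<Sum>i<d. v i * x i)) ` unit_sphere d"

definition err :: "(point \<times> real) measure \<Rightarrow> (point \<Rightarrow> real) \<Rightarrow> real" where
  "err D h = measure D {z \<in> space D. snd z \<noteq> h (fst z)}"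

text \<open>The minimum need not be attained for an arbitrary distribution, hence the infimum.\<close>

definition opt_err :: "(point \<Rightarrow> real) set \<Rightarrow> (point \<times> real) measure \<Rightarrow> real" where
  "opt_err H D = (INF f\<in>H. err D f)"

definition gaussian_class :: "nat \<Rightarrow> real \<Rightarrow> real \<Rightarrow> (point \<times> real) measure set" where
  "gaussian_class d \<epsilon> \<tau> = {D \<in> distributions d.
     distr D (Rn d) fst = std_gaussian d \<and> opt_err (halfspaces d) D \<le> 1/2 - \<epsilon> - 2 * \<tau>}"


section \<open>Statistical query algorithms\<close>

type_synonym query = "point \<times> real \<Rightarrow> real"

definition queries :: "nat \<Rightarrow> query set" where
  "queries d = {q \<in> borel_measurable (Rn d \<Otimes>\<^sub>M restrict_space borel {-1..1}).
     \<forall>z \<in> space (Rn d \<Otimes>\<^sub>M restrict_space borel {-1..1}). q z \<in> {-1..1}}"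

text \<open>
  A deterministic adaptive algorithm is a well-founded tree: it either stops with an output, or asks
  a query and continues depending on the real number it receives. A randomized algorithm is such a
  tree depending on a seed \<open>\<omega>\<close>, drawn from a probability space \<open>M\<close> over the reals (an arbitrary
  \<open>\<sigma>\<close>-algebra is allowed, so discrete coins and all standard Borel sources of randomness are covered).
\<close>

datatype (asked: 'q, outputs: 'r) sq_tree =
  Output 'r
| Ask 'q "real \<Rightarrow> ('q, 'r) sq_tree"

text \<open>
  An oracle answers the last query of a list on the basis of all queries asked so far. In
  \<open>sq_run t orc qs\<close> and \<open>sq_count t orc qs\<close>, \<open>qs\<close> are the queries asked before \<open>t\<close> is entered.
\<close>

primrec sq_run :: "('q, 'r) sq_tree \<Rightarrow> ('q list \<Rightarrow> real) \<Rightarrow> 'q list \<Rightarrow> 'r" where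
  "sq_run (Output r) = (\<lambda>orc qs. r)"
| "sq_run (Ask q k) = (\<lambda>orc qs. sq_run (k (orc (qs @ [q]))) orc (qs @ [q]))"

primrec sq_count :: "('q, 'r) sq_tree \<Rightarrow> ('q list \<Rightarrow> real) \<Rightarrow> 'q list \<Rightarrow> nat" where
  "sq_count (Output r) = (\<lambda>orc qs. 0)"
| "sq_count (Ask q k) = (\<lambda>orc qs. Suc (sq_count (k (orc (qs @ [q]))) orc (qs @ [q])))"

text \<open>
  The coarsest \<open>\<sigma>\<close>-algebra on queries for which every expectation \<open>q \<mapsto> E\<^sub>D[q]\<close> is measurable.
  Oracles are required to be measurable with respect to it: an oracle that depends on a query in a
  non-measurable way would leave the output probabilities of an algorithm with continuous
  randomness undefined.
\<close>

definition query_space :: "nat \<Rightarrow> query measure" where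
  "query_space d = sigma (queries d)
     {{q \<in> queries d. (\<integral>z. q z \<partial>D) \<le> r} | D r. D \<in> distributions d}"

text \<open>The admissible SQ oracles for \<open>D\<close> with tolerance \<open>\<tau>'\<close>; answers within the tolerance are arbitrary.\<close>

definition sq_oracles ::
  "nat \<Rightarrow> (point \<times> real) measure \<Rightarrow> real \<Rightarrow> (query list \<Rightarrow> real) set" where
  "sq_oracles d D \<tau>' = {orc.
     (\<forall>k. (\<lambda>qs. orc (map qs [0..<k])) \<in> borel_measurable (\<Pi>\<^sub>M i\<in>{..<k}. query_space d)) \<and>
     (\<forall>qs q. set qs \<subseteq> queries d \<longrightarrow> q \<in> queries d \<longrightarrow>
        \<bar>orc (qs @ [q]) - (\<integral>z. q z \<partial>D)\<bar> \<le> \<tau>')}"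

definition sq_algorithm :: "nat \<Rightarrow> real measure \<Rightarrow> (real \<Rightarrow> (query, 'r) sq_tree) \<Rightarrow> bool" where
  "sq_algorithm d M A \<longleftrightarrow> prob_space M \<and> (\<forall>\<omega>\<in>space M. asked (A \<omega>) \<subseteq> queries d)"

text \<open>Worst-case number of queries, for the input distributions in \<open>\<D>\<close>.\<close>

definition makes_at_most ::
  "nat \<Rightarrow> (point \<times> real) measure set \<Rightarrow> real \<Rightarrow> real measure \<Rightarrow> (real \<Rightarrow> (query, 'r) sq_tree) \<Rightarrow> nat \<Rightarrow> bool"
where
  "makes_at_most d \<D> \<tau>' M A m \<longleftrightarrow>
     (\<forall>D\<in>\<D>. \<forall>orc\<in>sq_oracles d D \<tau>'. \<forall>\<omega>\<in>space M. sq_count (A \<omega>) orc [] \<le> m)"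

definition out_event :: "real measure \<Rightarrow> (real \<Rightarrow> (query, 'r) sq_tree) \<Rightarrow> (query list \<Rightarrow> real)
    \<Rightarrow> ('r \<Rightarrow> bool) \<Rightarrow> real set" where
  "out_event M A orc P = {\<omega> \<in> space M. P (sq_run (A \<omega>) orc [])}"

text \<open>
  Guarantees of an SQ algorithm are required for all admissible oracles; membership in \<^term>\<open>sets M\<close>
  expresses that the probabilities spoken about exist.
\<close>

definition distinguishes ::
  "nat \<Rightarrow> (point \<times> real) measure \<Rightarrow> (point \<times> real) measure set \<Rightarrow> real \<Rightarrow> real
    \<Rightarrow> real measure \<Rightarrow> (real \<Rightarrow> (query, nat) sq_tree) \<Rightarrow> bool" where
  "distinguishes d N \<D> \<gamma> \<tau>' M A \<longleftrightarrow>
     (\<forall>D \<in> insert N \<D>. \<forall>orc \<in> sq_oracles d D \<tau>'. out_event M A orc (\<lambda>r. r = 1) \<in> sets M) \<and>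
     (\<forall>D \<in> \<D>. \<forall>orc\<^sub>0 \<in> sq_oracles d N \<tau>'. \<forall>orc \<in> sq_oracles d D \<tau>'.
        \<bar>measure M (out_event M A orc\<^sub>0 (\<lambda>r. r = 1)) - measure M (out_event M A orc (\<lambda>r. r = 1))\<bar> \<ge> \<gamma>)"

datatype verdict = Reject | Accept "point \<Rightarrow> real"

definition testable_learner ::
  "nat \<Rightarrow> (point \<Rightarrow> real) set \<Rightarrow> (point \<times> real) measure \<Rightarrow> real \<Rightarrow> real \<Rightarrow> real
    \<Rightarrow> real measure \<Rightarrow> (real \<Rightarrow> (query, verdict) sq_tree) \<Rightarrow> bool" where
  "testable_learner d H N \<epsilon> \<delta> \<tau>' M L \<longleftrightarrow>
     (\<forall>\<omega>\<in>space M. outputs (L \<omega>) \<subseteq> insert Reject (Accept ` hypotheses d)) \<and>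
     (\<forall>D \<in> distributions d. \<forall>orc \<in> sq_oracles d D \<tau>'.
        let sound = out_event M L orc (\<lambda>r. \<forall>h. r = Accept h \<longrightarrow> err D h \<le> opt_err H D + \<epsilon>)
        in sound \<in> sets M \<and> measure M sound \<ge> 1 - \<delta>) \<and>
     (\<forall>orc \<in> sq_oracles d N \<tau>'.
        let accepted = out_event M L orc (\<lambda>r. r \<noteq> Reject)
        in accepted \<in> sets M \<and> measure M accepted \<ge> 1 - \<delta>)"

end

theory Submission
  imports Defs "HOL-Real_Asymp.Real_Asymp"
begin

text \<open>
  The hard distributions have Gaussian \<open>x\<close> and \<open>E[y | x] = g (v \<bullet> x)\<close> for a hidden direction \<open>v\<close>.
  If the low moments of \<open>g\<close> vanish, the ridge functions \<open>g (u \<bullet> x)\<close> and \<open>g (v \<bullet> x)\<close> are nearly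
  uncorrelated for nearly orthogonal \<open>u\<close> and \<open>v\<close>, so by Cauchy-Schwarz a bounded query can tell
  only few of the distributions from pure noise. There are superpolynomially many nearly orthogonal
  directions, and an oracle that answers as for pure noise whenever it may leaves an algorithm with
  few queries blind to most of them.

  With \<open>n\<close> odd moments cancelled, \<open>g\<close> can still have correlation of order \<open>1/\<surd>n\<close> with the sign.
  An explicit combination of sine waves does this: the correlation of two Gaussian sine waves is a
  hyperbolic sine, whose power series replaces the Hermite expansion. For \<open>\<epsilon>\<close> bounded below, \<open>g\<close> is
  the sign function itself.
\<close>

section \<open>Linear forms of a Gaussian vector\<close>

text \<open>A label bias is a conditional mean of a sign, so \<open>g\<close> must be bounded by 1
  pointwise. This is the obstacle: subtracting the low-degree Hermite part from the sign function
  would leave an unbounded polynomial, whereas sine waves are bounded and have explicit Gaussian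
  correlations. Parameters: with \<open>r\<close> about \<open>d powr (1/4)\<close> there are
  \<open>fact r\<close> directions with inner products at most \<open>1 / r\<close>. Cancelling
  \<open>n\<close> odd moments brings the correlation of two bias functions down to
  \<open>(1 / r) ^ (2 * n + 1)\<close>. Since the sign correlation must stay of order \<epsilon>,
  \<open>n\<close> is taken of order \<open>1 / \<epsilon>\<^sup>2\<close>, and this is the origin
  of the exponent in the tolerance. Learners are not reduced to distinguishers. Measuring the error
  of the returned hypothesis would cost the extra \<open>2 * \<tau>\<close> of the class
  \<open>gaussian_class\<close> and stop at \<open>\<epsilon> \<le> 1/6\<close>, while learners are
  covered for all \<open>\<epsilon> < 1/2\<close>. They get a count of their own, with both signs of
  each bias function.\<close>

lemma sets_std_gaussian [measurable_cong]: "sets (std_gaussian d) = sets (Rn d)"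
  unfolding std_gaussian_def Rn_def by (intro sets_PiM_cong) auto

lemma space_std_gaussian: "space (std_gaussian d) = space (Rn d)"
  by (rule sets_eq_imp_space_eq[OF sets_std_gaussian])

lemma product_prob_space_std_normal: "product_prob_space (\<lambda>_. std_normal_distribution)"
  by (simp add: product_prob_space_def product_prob_space_axioms_def product_sigma_finite_def
      prob_space_normal_density prob_space_imp_sigma_finite)

lemma prob_space_std_gaussian: "prob_space (std_gaussian d)"
  unfolding std_gaussian_def by (intro prob_space_PiM prob_space_normal_density) simp

definition lin :: "nat \<Rightarrow> point \<Rightarrow> point \<Rightarrow> real" where
  "lin d w x = (\<Sum>i<d. w i * x i)"

lemma measurable_lin [measurable]: "lin d w \<in> borel_measurable (Rn d)"
proof -
  have "(\<lambda>x. x i) \<in> borel_measurable (Rn d)" if "i < d" for i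
    unfolding Rn_def using that by (intro measurable_component_singleton) auto
  then show ?thesis
    unfolding lin_def by (intro borel_measurable_sum borel_measurable_times) auto
qed

lemma lin_add: "lin d (\<lambda>i. a * u i + b * v i) x = a * lin d u x + b * lin d v x"
  unfolding lin_def by (simp add: sum.distrib sum_distrib_left algebra_simps)

lemma char_lin:
  "(\<integral>x. iexp (lin d w x) \<partial>std_gaussian d) = exp (- (\<Sum>i<d. (w i)\<^sup>2) / 2)"
proof -
  interpret product_prob_space "\<lambda>_::nat. std_normal_distribution"
    by (rule product_prob_space_std_normal)
  have "(\<integral>x. iexp (lin d w x) \<partial>std_gaussian d)
      = (\<integral>x. (\<Prod>i<d. iexp (w i * x i)) \<partial>std_gaussian d)"
    unfolding lin_def by (simp add: sum_distrib_left exp_sum)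
  also have "\<dots> = (\<Prod>i<d. char std_normal_distribution (w i))"
    unfolding std_gaussian_def char_def
    by (intro product_integral_prod finite_measure.integrable_const_bound[where B=1]
        prob_space.finite_measure prob_space_normal_density) auto
  also have "\<dots> = exp (- (\<Sum>i<d. (w i)\<^sup>2) / 2)"
    by (simp add: char_std_normal_distribution exp_sum[symmetric] sum_negf sum_divide_distrib
        flip: of_real_prod)
  finally show ?thesis .
qed

text \<open>By \<open>char_lin\<close> the characteristic function sees only the length of
  \<open>w\<close>, and it determines the law. The sign of \<sigma> is free, which later yields the
  symmetry of the normal law.\<close>

lemma distr_lin:
  assumes "(\<Sum>i<d. (w i)\<^sup>2) = \<sigma>\<^sup>2"
  shows "distr (std_gaussian d) borel (lin d w) = distr std_normal_distribution borel (\<lambda>z. \<sigma> * z)"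
proof (rule Levy_uniqueness)
  interpret prob_space "std_gaussian d" by (rule prob_space_std_gaussian)
  show "real_distribution (distr (std_gaussian d) borel (lin d w))"
    by (intro real_distribution_distr) measurable
  interpret N: prob_space std_normal_distribution by (rule prob_space_normal_density) simp
  show "real_distribution (distr std_normal_distribution borel (\<lambda>z. \<sigma> * z))"
    by (intro N.real_distribution_distr) measurable
  show "char (distr (std_gaussian d) borel (lin d w))
      = char (distr std_normal_distribution borel (\<lambda>z. \<sigma> * z))"
  proof
    fix t
    have "char (distr (std_gaussian d) borel (lin d w)) t
        = (\<integral>x. iexp (lin d (\<lambda>i. t * w i + 0 * 0) x) \<partial>std_gaussian d)"
      unfolding char_def lin_add by (subst integral_distr) auto
    also have "\<dots> = exp (- ((t * \<sigma>)\<^sup>2 / 2))"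
      unfolding char_lin by (simp add: power_mult_distrib assms flip: sum_distrib_left)
    also have "\<dots> = char std_normal_distribution (t * \<sigma>)"
      by (simp add: char_std_normal_distribution)
    also have "\<dots> = char (distr std_normal_distribution borel (\<lambda>z. \<sigma> * z)) t"
      unfolding char_def by (subst integral_distr) (auto simp: mult.assoc)
    finally show "char (distr (std_gaussian d) borel (lin d w)) t
      = char (distr std_normal_distribution borel (\<lambda>z. \<sigma> * z)) t" .
  qed
qed

lemma integral_lin:
  fixes f :: "real \<Rightarrow> real"
  assumes "(\<Sum>i<d. (w i)\<^sup>2) = \<sigma>\<^sup>2" and [measurable]: "f \<in> borel_measurable borel"
  shows "(\<integral>x. f (lin d w x) \<partial>std_gaussian d) = (\<integral>z. f (\<sigma> * z) \<partial>std_normal_distribution)"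
proof -
  have "(\<integral>x. f (lin d w x) \<partial>std_gaussian d) = (\<integral>z. f z \<partial>distr (std_gaussian d) borel (lin d w))"
    by (subst integral_distr) auto
  also have "\<dots> = (\<integral>z. f (\<sigma> * z) \<partial>std_normal_distribution)"
    unfolding distr_lin[OF assms(1)] by (subst integral_distr) auto
  finally show ?thesis .
qed

lemma integral_cos_lin:
  "(\<integral>x. cos (lin d w x) \<partial>std_gaussian d) = exp (- (\<Sum>i<d. (w i)\<^sup>2) / 2)"
proof -
  interpret prob_space "std_gaussian d" by (rule prob_space_std_gaussian)
  have "integrable (std_gaussian d) (\<lambda>x. iexp (lin d w x))"
    by (intro integrable_const_bound[where B=1]) auto
  then have "Re (\<integral>x. iexp (lin d w x) \<partial>std_gaussian d)
      = (\<integral>x. Re (iexp (lin d w x)) \<partial>std_gaussian d)"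
    by (simp only: integral_Re)
  also have "\<dots> = (\<integral>x. cos (lin d w x) \<partial>std_gaussian d)"
    by (simp add: Re_exp)
  finally show ?thesis by (simp add: char_lin)
qed

text \<open>The product-to-sum formula leaves cosines of the forms \<open>a u - b v\<close> and
  \<open>a u + b v\<close>. Their variances differ only in the sign of \<open>2 a b\<close> times
  the inner product, so the difference of the two characteristic functions is a
  \<open>sinh\<close>.\<close>

lemma integral_sin_sin_lin:
  assumes "(\<Sum>i<d. (u i)\<^sup>2) = 1" "(\<Sum>i<d. (v i)\<^sup>2) = 1"
  shows "(\<integral>x. sin (a * lin d u x) * sin (b * lin d v x) \<partial>std_gaussian d)
    = exp (- (a\<^sup>2 / 2)) * exp (- (b\<^sup>2 / 2)) * sinh (a * b * (\<Sum>i<d. u i * v i))"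
proof -
  interpret prob_space "std_gaussian d" by (rule prob_space_std_gaussian)
  define \<rho> where "\<rho> = (\<Sum>i<d. u i * v i)"
  have sq: "(\<Sum>i<d. (a * u i + c * v i)\<^sup>2) = a\<^sup>2 + c\<^sup>2 + 2 * a * c * \<rho>" for c
  proof -
    have "(\<Sum>i<d. (a * u i + c * v i)\<^sup>2)
      = (\<Sum>i<d. a\<^sup>2 * (u i)\<^sup>2 + c\<^sup>2 * (v i)\<^sup>2 + 2 * a * c * (u i * v i))"
      by (intro sum.cong) (auto simp: power2_eq_square algebra_simps)
    then show ?thesis
      by (simp add: sum.distrib assms \<rho>_def flip: sum_distrib_left)
  qed
  have int: "integrable (std_gaussian d) (\<lambda>x. cos (lin d w x))" for w
    by (intro integrable_const_bound[where B=1]) auto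
  have "(\<integral>x. sin (a * lin d u x) * sin (b * lin d v x) \<partial>std_gaussian d)
    = (\<integral>x. (cos (lin d (\<lambda>i. a * u i + (- b) * v i) x) - cos (lin d (\<lambda>i. a * u i + b * v i) x)) / 2
        \<partial>std_gaussian d)"
    unfolding lin_add by (simp add: sin_times_sin)
  also have "\<dots> = (exp (- (a\<^sup>2 + b\<^sup>2 - 2 * a * b * \<rho>) / 2) - exp (- (a\<^sup>2 + b\<^sup>2 + 2 * a * b * \<rho>) / 2)) / 2"
    using int[of "\<lambda>i. a * u i + (- b) * v i"] int[of "\<lambda>i. a * u i + b * v i"] sq[of b] sq[of "- b"]
    by (simp add: integral_cos_lin)
  also have "\<dots> = exp (- (a\<^sup>2 / 2)) * exp (- (b\<^sup>2 / 2)) * sinh (a * b * \<rho>)"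
    unfolding sinh_def by (simp add: field_simps flip: exp_add)
  finally show ?thesis unfolding \<rho>_def .
qed


section \<open>Distributions with a prescribed label bias\<close>

text \<open>For fixed \<open>x\<close> the density \<open>1 + y * f x\<close> averages to 1 over the
  two labels, so the marginal stays Gaussian, and the conditional mean of \<open>y\<close> becomes
  \<open>f x\<close>. The bound \<open>\<bar>f x\<bar> \<le> 1\<close> is what keeps it
  non-negative.\<close>

definition labelled :: "nat \<Rightarrow> (point \<Rightarrow> real) \<Rightarrow> (point \<times> real) measure" where
  "labelled d f = density (rcn_half d) (\<lambda>z. ennreal (1 + snd z * f (fst z)))"

lemma prob_space_labels: "prob_space (uniform_count_measure labels)"
  by (rule prob_space_uniform_count_measure) (auto simp: labels_def)

lemma sets_rcn_half [measurable_cong]: "sets (rcn_half d) = sets (Rn d \<Otimes>\<^sub>M count_space labels)"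
  unfolding rcn_half_def
  by (intro sets_pair_measure_cong sets_std_gaussian)
    (simp add: uniform_count_measure_def sets_point_measure)

lemma space_rcn_half: "space (rcn_half d) = space (Rn d) \<times> labels"
  by (simp add: sets_eq_imp_space_eq[OF sets_rcn_half] space_pair_measure)

lemma sets_labelled [measurable_cong]:
  "sets (labelled d f) = sets (Rn d \<Otimes>\<^sub>M count_space labels)"
  by (simp add: labelled_def sets_rcn_half)

lemma space_labelled: "space (labelled d f) = space (Rn d) \<times> labels"
  by (simp add: labelled_def space_rcn_half)

lemma measurable_id_labels: "(\<lambda>y. y) \<in> borel_measurable (count_space labels)"
  by simp

lemma measurable_snd_labels [measurable]: "snd \<in> borel_measurable (Rn d \<Otimes>\<^sub>M count_space labels)"
  by (rule measurable_compose[OF measurable_snd measurable_id_labels])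

lemma prob_space_rcn_half: "prob_space (rcn_half d)"
proof -
  interpret X: prob_space "std_gaussian d" by (rule prob_space_std_gaussian)
  interpret Y: prob_space "uniform_count_measure labels" by (rule prob_space_labels)
  interpret pair_prob_space "std_gaussian d" "uniform_count_measure labels" ..
  show ?thesis unfolding rcn_half_def by (rule prob_space_axioms)
qed

lemma integral_rcn_half:
  fixes F :: "point \<times> real \<Rightarrow> real"
  assumes [measurable]: "F \<in> borel_measurable (Rn d \<Otimes>\<^sub>M count_space labels)"
    and "\<And>z. z \<in> space (Rn d) \<times> labels \<Longrightarrow> \<bar>F z\<bar> \<le> B"
  shows "(\<integral>z. F z \<partial>rcn_half d) = (\<integral>x. (F (x, 1) + F (x, -1)) / 2 \<partial>std_gaussian d)"
proof -
  interpret X: prob_space "std_gaussian d" by (rule prob_space_std_gaussian)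
  interpret Y: prob_space "uniform_count_measure labels" by (rule prob_space_labels)
  interpret P: pair_prob_space "std_gaussian d" "uniform_count_measure labels" ..
  interpret prob_space "rcn_half d" by (rule prob_space_rcn_half)
  have "integrable (rcn_half d) F"
    using assms(2) by (intro integrable_const_bound[where B=B] AE_I2) (auto simp: space_rcn_half)
  then have "(\<integral>z. F z \<partial>rcn_half d)
      = (\<integral>x. (\<integral>y. F (x, y) \<partial>uniform_count_measure labels) \<partial>std_gaussian d)"
    unfolding rcn_half_def by (rule P.integral_fst'[symmetric])
  also have "\<dots> = (\<integral>x. (F (x, 1) + F (x, -1)) / 2 \<partial>std_gaussian d)"
    by (subst integral_uniform_count_measure) (auto simp: labels_def add.commute)
  finally show ?thesis .
qed

lemma integral_labelled:
  assumes [measurable]: "f \<in> borel_measurable (Rn d)"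
    and f: "\<And>x. \<bar>f x\<bar> \<le> 1"
    and [measurable]: "F \<in> borel_measurable (Rn d \<Otimes>\<^sub>M count_space labels)"
    and F: "\<And>z. z \<in> space (Rn d) \<times> labels \<Longrightarrow> \<bar>F z\<bar> \<le> B"
  shows "(\<integral>z. F z \<partial>labelled d f)
    = (\<integral>x. (F (x, 1) * (1 + f x) + F (x, -1) * (1 - f x)) / 2 \<partial>std_gaussian d)"
proof -
  have pos: "0 \<le> 1 + snd z * f (fst z)" if "z \<in> space (Rn d) \<times> labels" for z
    using f[of "fst z"] that by (auto simp: labels_def)
  have "\<bar>(1 + snd z * f (fst z)) * F z\<bar> \<le> 2 * B" if "z \<in> space (Rn d) \<times> labels" for z
  proof -
    have "\<bar>1 + snd z * f (fst z)\<bar> \<le> 2"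
      using f[of "fst z"] that by (auto simp: labels_def)
    then show ?thesis unfolding abs_mult using F[OF that] by (intro mult_mono) auto
  qed
  note bd = this
  have "(\<integral>z. F z \<partial>labelled d f) = (\<integral>z. (1 + snd z * f (fst z)) * F z \<partial>rcn_half d)"
    unfolding labelled_def
    by (subst integral_density) (auto intro!: AE_I2 pos simp: space_rcn_half)
  also have "\<dots> = (\<integral>x. (F (x, 1) * (1 + f x) + F (x, -1) * (1 - f x)) / 2 \<partial>std_gaussian d)"
    by (subst integral_rcn_half[OF _ bd]) (auto simp: algebra_simps)
  finally show ?thesis .
qed

lemma prob_space_labelled:
  assumes [measurable]: "f \<in> borel_measurable (Rn d)" and f: "\<And>x. \<bar>f x\<bar> \<le> 1"
  shows "prob_space (labelled d f)"
proof
  interpret R: prob_space "rcn_half d" by (rule prob_space_rcn_half)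
  interpret X: prob_space "std_gaussian d" by (rule prob_space_std_gaussian)
  let ?w = "\<lambda>z. 1 + snd z * f (fst z)"
  have bd: "0 \<le> ?w z" "\<bar>?w z\<bar> \<le> 2" if "z \<in> space (Rn d) \<times> labels" for z
    using f[of "fst z"] that by (auto simp: labels_def)
  have "emeasure (labelled d f) (space (labelled d f)) = (\<integral>\<^sup>+z. ennreal (?w z) \<partial>rcn_half d)"
    unfolding labelled_def by (simp add: emeasure_density cong: nn_integral_cong)
  also have "\<dots> = ennreal (\<integral>z. ?w z \<partial>rcn_half d)"
  proof (intro nn_integral_eq_integral R.integrable_const_bound[where B=2] AE_I2)
    fix z assume "z \<in> space (rcn_half d)"
    then show "0 \<le> ?w z" "norm (?w z) \<le> 2"
      using bd[of z] by (simp_all add: space_rcn_half)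
  qed measurable
  also have "(\<integral>z. ?w z \<partial>rcn_half d) = 1"
    using bd by (subst integral_rcn_half[where B=2]) (auto simp: X.prob_space)
  finally show "emeasure (labelled d f) (space (labelled d f)) = 1" by simp
qed

lemma labelled_in_distributions:
  assumes "f \<in> borel_measurable (Rn d)" "\<And>x. \<bar>f x\<bar> \<le> 1"
  shows "labelled d f \<in> distributions d"
  using prob_space_labelled[OF assms] by (simp add: distributions_def sets_labelled)

lemma rcn_half_in_distributions: "rcn_half d \<in> distributions d"
  by (simp add: distributions_def sets_rcn_half prob_space_rcn_half)

lemma distr_fst_labelled:
  assumes [measurable]: "f \<in> borel_measurable (Rn d)" and f: "\<And>x. \<bar>f x\<bar> \<le> 1"
  shows "distr (labelled d f) (Rn d) fst = std_gaussian d"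
proof (rule measure_eqI)
  interpret L: prob_space "labelled d f" by (rule prob_space_labelled) fact+
  interpret X: prob_space "std_gaussian d" by (rule prob_space_std_gaussian)
  fix A assume "A \<in> sets (distr (labelled d f) (Rn d) fst)"
  then have [measurable]: "A \<in> sets (Rn d)" by simp
  have "emeasure (distr (labelled d f) (Rn d) fst) A
      = emeasure (labelled d f) (A \<times> labels)"
    using sets.sets_into_space[OF \<open>A \<in> sets (Rn d)\<close>]
    by (subst emeasure_distr) (auto simp: space_labelled intro!: arg_cong[where f="emeasure _"])
  also have "\<dots> = ennreal (\<integral>z. indicator (A \<times> labels) z \<partial>labelled d f)"
    by (simp add: L.emeasure_eq_measure sets_labelled)
  also have "(\<integral>z. indicator (A \<times> labels) z \<partial>labelled d f) = (\<integral>x. indicator A x \<partial>std_gaussian d :: real)"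
  proof -
    have "(\<integral>z. indicator (A \<times> labels) z \<partial>labelled d f)
      = (\<integral>x. (indicator (A \<times> labels) (x, 1) * (1 + f x) + indicator (A \<times> labels) (x, -1) * (1 - f x)) / 2
          \<partial>std_gaussian d)"
      by (rule integral_labelled[where B=1]) (auto simp: f intro!: borel_measurable_indicator)
    also have "\<dots> = (\<integral>x. indicator A x \<partial>std_gaussian d)"
      by (intro Bochner_Integration.integral_cong) (auto simp: labels_def indicator_def)
    finally show ?thesis .
  qed
  also have "ennreal \<dots> = emeasure (std_gaussian d) A"
    by (simp add: X.emeasure_eq_measure sets_std_gaussian)
  finally show "emeasure (distr (labelled d f) (Rn d) fst) A = emeasure (std_gaussian d) A" .
qed (simp add: sets_std_gaussian)

lemma hypotheses_borel: "h \<in> hypotheses d \<Longrightarrow> h \<in> borel_measurable (Rn d)"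
  unfolding hypotheses_def by (rule measurable_compose[OF _ measurable_id_labels])

lemma hypotheses_labels: "h \<in> hypotheses d \<Longrightarrow> x \<in> space (Rn d) \<Longrightarrow> h x \<in> labels"
  unfolding hypotheses_def using measurable_space[of h "Rn d" "count_space labels" x] by simp

text \<open>For labels and hypotheses with values in \<open>{-1, 1}\<close> the indicator of an
  error is \<open>(1 - y * h x) / 2\<close>, and \<open>f x\<close> is the conditional mean of
  \<open>y\<close>.\<close>

lemma err_labelled:
  assumes [measurable]: "f \<in> borel_measurable (Rn d)" and f: "\<And>x. \<bar>f x\<bar> \<le> 1"
    and h: "h \<in> hypotheses d"
  shows "err (labelled d f) h = 1/2 - (\<integral>x. h x * f x \<partial>std_gaussian d) / 2"
proof -
  interpret L: prob_space "labelled d f" by (rule prob_space_labelled) fact+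
  interpret X: prob_space "std_gaussian d" by (rule prob_space_std_gaussian)
  note [measurable] = hypotheses_borel[OF h]
  let ?A = "{z \<in> space (labelled d f). snd z \<noteq> h (fst z)}"
  have A [measurable]: "?A \<in> sets (Rn d \<Otimes>\<^sub>M count_space labels)"
  proof -
    have "?A = {z \<in> space (Rn d \<Otimes>\<^sub>M count_space labels). snd z \<noteq> h (fst z)}"
      by (simp add: space_labelled space_pair_measure)
    also have "\<dots> \<in> sets (Rn d \<Otimes>\<^sub>M count_space labels)" by measurable
    finally show ?thesis .
  qed
  have hl: "h x = 1 \<or> h x = -1" if "x \<in> space (Rn d)" for x
    using hypotheses_labels[OF h that] by (auto simp: labels_def)
  have hf: "integrable (std_gaussian d) (\<lambda>x. h x * f x)"
  proof (intro X.integrable_const_bound[where B=1] AE_I2)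
    show "norm (h x * f x) \<le> 1" if "x \<in> space (std_gaussian d)" for x
      using hl[of x] f[of x] that by (auto simp: space_std_gaussian)
  qed measurable
  have "err (labelled d f) h = (\<integral>z. indicator ?A z \<partial>labelled d f)"
    unfolding err_def using A by (simp add: sets_labelled)
  also have "\<dots> = (\<integral>x. (indicator ?A (x, 1) * (1 + f x) + indicator ?A (x, -1) * (1 - f x)) / 2
      \<partial>std_gaussian d)"
    by (rule integral_labelled[where B=1]) (auto simp: f)
  also have "\<dots> = (\<integral>x. 1/2 - h x * f x / 2 \<partial>std_gaussian d)"
  proof (intro Bochner_Integration.integral_cong refl)
    fix x assume "x \<in> space (std_gaussian d)"
    then show "(indicator ?A (x, 1) * (1 + f x) + indicator ?A (x, -1) * (1 - f x)) / 2
        = 1/2 - h x * f x / 2"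
      using hl[of x] by (auto simp: space_labelled labels_def space_std_gaussian field_simps)
  qed
  also have "\<dots> = 1/2 - (\<integral>x. h x * f x \<partial>std_gaussian d) / 2"
    using Bochner_Integration.integral_diff[OF _ integrable_divide[OF hf, of 2], of "\<lambda>_. 1/2"]
    by (simp add: X.prob_space)
  finally show ?thesis .
qed

section \<open>What a query can see of the label bias\<close>

lemma queries_measurable:
  assumes "q \<in> queries d"
  shows "q \<in> borel_measurable (Rn d \<Otimes>\<^sub>M count_space labels)"
proof -
  \<comment> \<open>Queries accept any label in \<open>{-1..1}\<close>, whereas distributions live
    on the discrete two-point space; the inclusion of the latter mediates.\<close>
  have id: "(\<lambda>y. y) \<in> count_space labels \<rightarrow>\<^sub>M restrict_space borel {-1..1::real}"
    unfolding measurable_count_space_eq1 by (simp add: space_restrict_space labels_def)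
  have "(\<lambda>z. snd z) \<in> Rn d \<Otimes>\<^sub>M count_space labels \<rightarrow>\<^sub>M restrict_space borel {-1..1::real}"
    using measurable_compose[OF measurable_snd[of "Rn d"] id] by simp
  with measurable_fst have "(\<lambda>z. (fst z, snd z))
      \<in> Rn d \<Otimes>\<^sub>M count_space labels \<rightarrow>\<^sub>M Rn d \<Otimes>\<^sub>M restrict_space borel {-1..1::real}"
    by (rule measurable_Pair)
  moreover have "q \<in> borel_measurable (Rn d \<Otimes>\<^sub>M restrict_space borel {-1..1})"
    using assms by (simp add: queries_def)
  ultimately have "(\<lambda>z. q (fst z, snd z)) \<in> borel_measurable (Rn d \<Otimes>\<^sub>M count_space labels)"
    by (rule measurable_compose)
  then show ?thesis by simp
qed

lemma queries_bounded:
  assumes "q \<in> queries d" "z \<in> space (Rn d) \<times> labels"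
  shows "\<bar>q z\<bar> \<le> 1"
proof -
  have "z \<in> space (Rn d \<Otimes>\<^sub>M restrict_space borel {-1..1})"
    using assms(2) by (auto simp: space_pair_measure space_restrict_space labels_def)
  with assms(1) have "q z \<in> {-1..1}" unfolding queries_def by blast
  then show ?thesis by auto
qed

lemma measurable_query_section:
  assumes "q \<in> queries d" "y \<in> labels"
  shows "(\<lambda>x. q (x, y)) \<in> borel_measurable (Rn d)"
proof (rule measurable_compose[OF _ queries_measurable[OF assms(1)]])
  show "(\<lambda>x. (x, y)) \<in> Rn d \<rightarrow>\<^sub>M Rn d \<Otimes>\<^sub>M count_space labels"
    using assms(2) by (intro measurable_Pair2') simp
qed

text \<open>The part of the query that is odd in the label. The even part has the same mean under
  every \<open>labelled d f\<close>, so only this part carries information about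
  \<open>f\<close>.\<close>

definition label_part :: "query \<Rightarrow> point \<Rightarrow> real" where
  "label_part q x = (q (x, 1) - q (x, -1)) / 2"

lemma measurable_label_part:
  assumes "q \<in> queries d"
  shows "label_part q \<in> borel_measurable (Rn d)"
  using measurable_query_section[OF assms, of 1] measurable_query_section[OF assms, of "-1"]
  unfolding label_part_def by (simp add: labels_def)

lemma label_part_bounded:
  assumes "q \<in> queries d" "x \<in> space (Rn d)"
  shows "\<bar>label_part q x\<bar> \<le> 1"
  using queries_bounded[OF assms(1), of "(x, 1)"] queries_bounded[OF assms(1), of "(x, -1)"] assms(2)
  by (auto simp: label_part_def labels_def)

lemma query_diff:
  assumes [measurable]: "f \<in> borel_measurable (Rn d)" and f: "\<And>x. \<bar>f x\<bar> \<le> 1"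
    and q: "q \<in> queries d"
  shows "(\<integral>z. q z \<partial>labelled d f) - (\<integral>z. q z \<partial>rcn_half d)
    = (\<integral>x. label_part q x * f x \<partial>std_gaussian d)"
proof -
  interpret X: prob_space "std_gaussian d" by (rule prob_space_std_gaussian)
  note [measurable] = queries_measurable[OF q] measurable_label_part[OF q]
  have [measurable]: "(\<lambda>x. q (x, 1)) \<in> borel_measurable (Rn d)" "(\<lambda>x. q (x, -1)) \<in> borel_measurable (Rn d)"
    using measurable_query_section[OF q, of 1] measurable_query_section[OF q, of "-1"]
    by (simp_all add: labels_def)
  have i1: "integrable (std_gaussian d) (\<lambda>x. (q (x, 1) + q (x, -1)) / 2)"
  proof (intro X.integrable_const_bound[where B=1] AE_I2)
    fix x assume "x \<in> space (std_gaussian d)"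
    then show "norm ((q (x, 1) + q (x, -1)) / 2) \<le> 1"
      using queries_bounded[OF q, of "(x, 1)"] queries_bounded[OF q, of "(x, -1)"]
      by (auto simp: space_std_gaussian labels_def)
  qed measurable
  have i2: "integrable (std_gaussian d) (\<lambda>x. label_part q x * f x)"
  proof (intro X.integrable_const_bound[where B=1] AE_I2)
    fix x assume "x \<in> space (std_gaussian d)"
    then show "norm (label_part q x * f x) \<le> 1"
      using label_part_bounded[OF q, of x] f[of x]
      by (auto simp: space_std_gaussian abs_mult intro!: mult_le_one)
  qed measurable
  have "(\<integral>z. q z \<partial>labelled d f)
      = (\<integral>x. (q (x, 1) * (1 + f x) + q (x, -1) * (1 - f x)) / 2 \<partial>std_gaussian d)"
    by (intro integral_labelled[where B=1]) (auto simp: f intro!: queries_bounded[OF q])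
  also have "\<dots> = (\<integral>x. (q (x, 1) + q (x, -1)) / 2 + label_part q x * f x \<partial>std_gaussian d)"
    by (intro Bochner_Integration.integral_cong) (auto simp: label_part_def field_simps)
  also have "\<dots> = (\<integral>x. (q (x, 1) + q (x, -1)) / 2 \<partial>std_gaussian d)
      + (\<integral>x. label_part q x * f x \<partial>std_gaussian d)"
    by (rule Bochner_Integration.integral_add[OF i1 i2])
  also have "(\<integral>x. (q (x, 1) + q (x, -1)) / 2 \<partial>std_gaussian d) = (\<integral>z. q z \<partial>rcn_half d)"
    by (intro integral_rcn_half[where B=1, symmetric]) (auto intro!: queries_bounded[OF q])
  finally show ?thesis by simp
qed


section \<open>Statistical queries against weakly correlated distributions\<close>

primrec sq_path :: "('q, 'r) sq_tree \<Rightarrow> ('q \<Rightarrow> real) \<Rightarrow> 'q list" where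
  "sq_path (Output r) = (\<lambda>F. [])"
| "sq_path (Ask q k) = (\<lambda>F. q # sq_path (k (F q)) F)"

text \<open>Guarantees hold for every admissible oracle, so oracles that ignore the history suffice
  for lower bounds. The value 0 at \<open>[]\<close> is a default: \<open>sq_run\<close> consults
  oracles at lists \<open>qs @ [q]\<close> only.\<close>

definition last_oracle :: "('q \<Rightarrow> real) \<Rightarrow> 'q list \<Rightarrow> real" where
  "last_oracle F qs = (if qs = [] then 0 else F (last qs))"

lemma last_oracle_snoc [simp]: "last_oracle F (qs @ [q]) = F q"
  by (simp add: last_oracle_def)

lemma sq_count_last_oracle: "sq_count t (last_oracle F) qs = length (sq_path t F)"
  by (induction t arbitrary: qs) auto

lemma set_sq_path: "set (sq_path t F) \<subseteq> asked t"
  by (induction t) auto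

text \<open>Agreement is demanded only along the path taken under \<open>F\<close>: while the
  answers coincide, the run under \<open>G\<close> asks the very same queries.\<close>

lemma sq_run_cong:
  "\<forall>q\<in>set (sq_path t F). F q = G q \<Longrightarrow> sq_run t (last_oracle G) qs = sq_run t (last_oracle F) qs"
  by (induction t arbitrary: qs) auto

lemma sq_run_in_outputs: "sq_run t orc qs \<in> outputs t"
proof (induction t arbitrary: qs)
  case (Ask q k)
  then have "sq_run (k (orc (qs @ [q]))) orc (qs @ [q]) \<in> outputs (k (orc (qs @ [q])))" by blast
  then show ?case by auto
qed simp

lemma space_query_space: "space (query_space d) = queries d"
  unfolding query_space_def by (rule space_measure_of) auto

lemma measurable_query_mean:
  assumes "D \<in> distributions d"
  shows "(\<lambda>q. \<integral>z. q z \<partial>D) \<in> borel_measurable (query_space d)"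
proof (rule borel_measurableI_le)
  fix r
  have "{q \<in> space (query_space d). (\<integral>z. q z \<partial>D) \<le> r}
    \<in> {{q \<in> queries d. (\<integral>z. q z \<partial>D) \<le> r} | D r. D \<in> distributions d}"
    using assms unfolding space_query_space by blast
  then show "{q \<in> space (query_space d). (\<integral>z. q z \<partial>D) \<le> r} \<in> sets (query_space d)"
    unfolding query_space_def by (subst sets_measure_of) auto
qed

lemma last_oracle_admissible:
  assumes F: "F \<in> borel_measurable (query_space d)"
    and "\<And>q. q \<in> queries d \<Longrightarrow> \<bar>F q - (\<integral>z. q z \<partial>D)\<bar> \<le> \<tau>"
  shows "last_oracle F \<in> sq_oracles d D \<tau>"
proof -
  have "(\<lambda>qs. last_oracle F (map qs [0..<k])) \<in> borel_measurable (\<Pi>\<^sub>M i\<in>{..<k}. query_space d)" for k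
  proof (cases k)
    case (Suc j)
    have "(\<lambda>qs. F (qs j)) \<in> borel_measurable (\<Pi>\<^sub>M i\<in>{..<k}. query_space d)"
      by (rule measurable_compose[OF _ F], rule measurable_component_singleton) (simp add: Suc)
    then show ?thesis by (simp add: last_oracle_def Suc)
  qed (simp add: last_oracle_def)
  with assms(2) show ?thesis by (simp add: sq_oracles_def)
qed

text \<open>The sum is the expected number of events that occur. This reduces a randomized algorithm
  to a count for each fixed seed.\<close>

lemma sum_measure_le:
  assumes "prob_space M" "finite I" "\<And>i. i \<in> I \<Longrightarrow> E i \<in> sets M"
    and K: "\<And>\<omega>. \<omega> \<in> space M \<Longrightarrow> real (card {i \<in> I. \<omega> \<in> E i}) \<le> K"
  shows "(\<Sum>i\<in>I. measure M (E i)) \<le> K"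
proof -
  interpret prob_space M by fact
  have int: "integrable M (\<lambda>\<omega>. indicat_real (E i) \<omega>)" if "i \<in> I" for i
    using assms(3)[OF that] by (intro integrable_const_bound[where B=1]) auto
  have "(\<Sum>i\<in>I. measure M (E i)) = (\<Sum>i\<in>I. \<integral>\<omega>. indicat_real (E i) \<omega> \<partial>M)"
    using assms(3) by (intro sum.cong) auto
  also have "\<dots> = (\<integral>\<omega>. (\<Sum>i\<in>I. indicat_real (E i) \<omega>) \<partial>M)"
    by (rule Bochner_Integration.integral_sum[symmetric]) (rule int)
  also have "\<dots> \<le> (\<integral>\<omega>. K \<partial>M)"
  proof (rule integral_mono)
    fix \<omega> assume "\<omega> \<in> space M"
    moreover have "(\<Sum>i\<in>I. indicat_real (E i) \<omega>) = card {i \<in> I. \<omega> \<in> E i}"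
      using assms(2) by (simp add: indicator_def Int_def)
    ultimately show "(\<Sum>i\<in>I. indicat_real (E i) \<omega>) \<le> K" using K by simp
  qed (auto intro!: int)
  finally show ?thesis by (simp add: prob_space)
qed

section \<open>Counting bounds for families of nearly uncorrelated bias functions\<close>

locale hard_family =
  fixes d :: nat and V :: "'v set" and f :: "'v \<Rightarrow> point \<Rightarrow> real" and \<tau> :: real
  assumes finite_V: "finite V"
    and f_measurable: "\<And>v. v \<in> V \<Longrightarrow> f v \<in> borel_measurable (Rn d)"
    and f_bounded: "\<And>v x. v \<in> V \<Longrightarrow> \<bar>f v x\<bar> \<le> 1"
    and f_correlation: "\<And>u v. u \<in> V \<Longrightarrow> v \<in> V \<Longrightarrow> u \<noteq> v \<Longrightarrow>
      2 * \<bar>\<integral>x. f u x * f v x \<partial>std_gaussian d\<bar> \<le> \<tau>\<^sup>2"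
    and tau_pos: "\<tau> > 0"
begin

definition detected :: "query \<Rightarrow> 'v set" where
  "detected q = {v \<in> V. \<bar>\<integral>x. label_part q x * f v x \<partial>std_gaussian d\<bar> > \<tau>}"

text \<open>Let \<open>h\<close> be the sum of the detected functions, each with the sign of its
  correlation with the query. Then \<open>h\<close> correlates with the query by at least
  \<open>card S * \<tau>\<close>, while near-orthogonality bounds its second moment by
  \<open>card S + (card S)\<^sup>2 * \<tau>\<^sup>2 / 2\<close>. The factor 2 in
  \<open>f_correlation\<close> leaves half of the quadratic term, which bounds
  \<open>card S\<close>.\<close>

lemma card_detected:
  assumes q: "q \<in> queries d"
  shows "real (card (detected q)) \<le> 2 / \<tau>\<^sup>2"
proof -
  interpret X: prob_space "std_gaussian d" by (rule prob_space_std_gaussian)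
  define S where "S = detected q"
  have SV: "S \<subseteq> V" and fin: "finite S"
    using finite_V by (auto simp: S_def detected_def)
  define p where "p = label_part q"
  define \<sigma> where "\<sigma> v = sgn (\<integral>x. p x * f v x \<partial>std_gaussian d)" for v
  define h where "h x = (\<Sum>v\<in>S. \<sigma> v * f v x)" for x
  have [measurable]: "p \<in> borel_measurable (Rn d)"
    unfolding p_def by (rule measurable_label_part[OF q])
  have fm: "f v \<in> borel_measurable (Rn d)" if "v \<in> S" for v
    using f_measurable SV that by auto
  have [measurable]: "h \<in> borel_measurable (Rn d)"
    unfolding h_def using fm by (intro borel_measurable_sum borel_measurable_times) auto
  have p1: "\<bar>p x\<bar> \<le> 1" if "x \<in> space (std_gaussian d)" for x
    unfolding p_def using that by (intro label_part_bounded[OF q]) (simp add: space_std_gaussian)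
  have \<sigma>1: "\<bar>\<sigma> v\<bar> \<le> 1" for v by (simp add: \<sigma>_def abs_sgn_eq)
  have h_bd: "\<bar>h x\<bar> \<le> card S" for x
  proof -
    have "\<bar>h x\<bar> \<le> (\<Sum>v\<in>S. \<bar>\<sigma> v * f v x\<bar>)" unfolding h_def by (rule sum_abs)
    also have "\<dots> \<le> (\<Sum>v\<in>S. 1)"
      using f_bounded SV \<sigma>1 by (intro sum_mono) (auto simp: abs_mult intro!: mult_le_one)
    finally show ?thesis by simp
  qed
  have int_pf: "integrable (std_gaussian d) (\<lambda>x. p x * f v x)" if "v \<in> S" for v
    using f_bounded SV that fm p1
    by (intro X.integrable_const_bound[where B=1] AE_I2) (auto simp: abs_mult intro!: mult_le_one)
  have int_ff: "integrable (std_gaussian d) (\<lambda>x. f u x * f v x)" if "u \<in> S" "v \<in> S" for u v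
    using f_bounded SV that fm
    by (intro X.integrable_const_bound[where B=1] AE_I2) (auto simp: abs_mult intro!: mult_le_one)
  have int_hh: "integrable (std_gaussian d) (\<lambda>x. (h x)\<^sup>2)"
  proof (intro X.integrable_const_bound[where B="(card S)\<^sup>2"] AE_I2)
    show "norm ((h x)\<^sup>2) \<le> (card S)\<^sup>2" for x
      using power_mono[OF h_bd, of x 2] by simp
  qed measurable
  have ph_bd: "\<bar>p x * h x\<bar> \<le> card S" if "x \<in> space (std_gaussian d)" for x
    using mult_mono[OF p1[OF that] h_bd] by (simp add: abs_mult)
  have int_ph: "integrable (std_gaussian d) (\<lambda>x. p x * h x)"
    using ph_bd by (intro X.integrable_const_bound[where B="card S"] AE_I2) auto
  have int_ph2: "integrable (std_gaussian d) (\<lambda>x. (p x * h x)\<^sup>2)"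
  proof (intro X.integrable_const_bound[where B="(card S)\<^sup>2"] AE_I2)
    fix x assume "x \<in> space (std_gaussian d)"
    from power_mono[OF ph_bd[OF this], of 2] show "norm ((p x * h x)\<^sup>2) \<le> (card S)\<^sup>2"
      by simp
  qed measurable
  have "card S * \<tau> = (\<Sum>v\<in>S. \<tau>)" by simp
  also have "\<dots> \<le> (\<Sum>v\<in>S. \<sigma> v * (\<integral>x. p x * f v x \<partial>std_gaussian d))"
    unfolding \<sigma>_def by (intro sum_mono) (auto simp: S_def detected_def p_def sgn_if split: if_splits)
  also have "\<dots> = (\<integral>x. (\<Sum>v\<in>S. \<sigma> v * (p x * f v x)) \<partial>std_gaussian d)"
    using int_pf by (subst Bochner_Integration.integral_sum) auto
  also have "\<dots> = (\<integral>x. p x * h x \<partial>std_gaussian d)"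
    unfolding h_def by (simp add: sum_distrib_left mult_ac)
  finally have "card S * \<tau> \<le> (\<integral>x. p x * h x \<partial>std_gaussian d)" .
  then have "(card S * \<tau>)\<^sup>2 \<le> (\<integral>x. p x * h x \<partial>std_gaussian d)\<^sup>2"
    using tau_pos by (intro power_mono) auto
  \<comment> \<open>Cauchy-Schwarz in the form of a non-negative variance; the bound
    \<open>\<bar>p x\<bar> \<le> 1\<close> then removes \<open>p\<close>.\<close>
  also have "\<dots> \<le> (\<integral>x. (p x * h x)\<^sup>2 \<partial>std_gaussian d)"
    using X.variance_positive[of "\<lambda>x. p x * h x"] X.variance_eq[OF int_ph int_ph2] by simp
  also have "\<dots> \<le> (\<integral>x. (h x)\<^sup>2 \<partial>std_gaussian d)"
  proof (rule integral_mono[OF int_ph2 int_hh])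
    fix x assume "x \<in> space (std_gaussian d)"
    from power_mono[OF p1[OF this], of 2] have "(p x)\<^sup>2 \<le> 1" by simp
    then show "(p x * h x)\<^sup>2 \<le> (h x)\<^sup>2"
      by (simp add: power_mult_distrib mult_left_le_one_le)
  qed
  also have "\<dots> = (\<integral>x. (\<Sum>u\<in>S. \<Sum>v\<in>S. (\<sigma> u * \<sigma> v) * (f u x * f v x)) \<partial>std_gaussian d)"
    unfolding h_def power2_eq_square sum_product by (simp add: mult_ac)
  also have "\<dots> = (\<Sum>u\<in>S. \<Sum>v\<in>S. (\<sigma> u * \<sigma> v) * (\<integral>x. f u x * f v x \<partial>std_gaussian d))"
    using int_ff by (simp add: Bochner_Integration.integral_sum)
  also have "\<dots> \<le> (\<Sum>u\<in>S. \<Sum>v\<in>S. (if u = v then 1 else 0) + \<tau>\<^sup>2 / 2)"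
  proof (intro sum_mono)
    fix u v assume uv: "u \<in> S" "v \<in> S"
    have "(\<sigma> u * \<sigma> v) * (\<integral>x. f u x * f v x \<partial>std_gaussian d)
        \<le> \<bar>\<sigma> u * \<sigma> v\<bar> * \<bar>\<integral>x. f u x * f v x \<partial>std_gaussian d\<bar>"
      by (simp flip: abs_mult)
    also have "\<dots> \<le> 1 * \<bar>\<integral>x. f u x * f v x \<partial>std_gaussian d\<bar>"
      using \<sigma>1 by (intro mult_right_mono) (auto simp: abs_mult intro!: mult_le_one)
    also have "\<dots> \<le> (if u = v then 1 else 0) + \<tau>\<^sup>2 / 2"
    proof (cases "u = v")
      case True
      have "\<bar>\<integral>x. f u x * f v x \<partial>std_gaussian d\<bar> \<le> (\<integral>x. \<bar>f u x * f v x\<bar> \<partial>std_gaussian d)"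
        by (rule integral_abs_bound)
      also have "\<dots> \<le> (\<integral>x. 1 \<partial>std_gaussian d)"
        using f_bounded SV uv by (intro integral_mono integrable_abs int_ff)
          (auto simp: abs_mult intro!: mult_le_one)
      finally show ?thesis using True by (simp add: X.prob_space add_increasing2)
    next
      case False
      then show ?thesis using f_correlation[of u v] subsetD[OF SV uv(1)] subsetD[OF SV uv(2)] by simp
    qed
    finally show "(\<sigma> u * \<sigma> v) * (\<integral>x. f u x * f v x \<partial>std_gaussian d)
      \<le> (if u = v then 1 else 0) + \<tau>\<^sup>2 / 2" .
  qed
  also have "\<dots> = card S + (card S)\<^sup>2 * (\<tau>\<^sup>2 / 2)"
    using fin by (simp add: sum.distrib power2_eq_square algebra_simps)
  finally have "card S * (card S * \<tau>\<^sup>2) \<le> card S * 2"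
    by (simp add: power2_eq_square algebra_simps)
  then have "card S * \<tau>\<^sup>2 \<le> 2"
    by (cases "card S = 0") auto
  then show ?thesis
    using tau_pos by (simp add: S_def field_simps)
qed

definition signed :: "real \<Rightarrow> 'v \<Rightarrow> (point \<times> real) measure" where
  "signed s v = labelled d (\<lambda>x. s * f v x)"

definition null_mean :: "query \<Rightarrow> real" where
  "null_mean q = (\<integral>z. q z \<partial>rcn_half d)"

text \<open>Gives away nothing about the input distribution unless the query detects it.\<close>

definition evasive :: "real \<Rightarrow> 'v \<Rightarrow> query \<Rightarrow> real" where
  "evasive s v q = (if \<bar>(\<integral>z. q z \<partial>signed s v) - null_mean q\<bar> \<le> \<tau> then null_mean q
     else (\<integral>z. q z \<partial>signed s v))"

lemma signed_measurable:
  assumes "v \<in> V" "\<bar>s\<bar> \<le> 1"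
  shows "(\<lambda>x. s * f v x) \<in> borel_measurable (Rn d)" "\<bar>s * f v x\<bar> \<le> 1"
  using f_measurable[OF assms(1)] f_bounded[OF assms(1), of x] assms(2)
  by (auto simp: abs_mult intro!: mult_le_one)

lemma signed_in_distributions: "v \<in> V \<Longrightarrow> \<bar>s\<bar> \<le> 1 \<Longrightarrow> signed s v \<in> distributions d"
  unfolding signed_def by (intro labelled_in_distributions signed_measurable)

lemma evasive_eq_null:
  assumes "v \<in> V" "\<bar>s\<bar> = 1" "q \<in> queries d" "v \<notin> detected q"
  shows "evasive s v q = null_mean q"
proof -
  have "(\<integral>z. q z \<partial>signed s v) - null_mean q = s * (\<integral>x. label_part q x * f v x \<partial>std_gaussian d)"
    unfolding signed_def null_mean_def using assms
    by (subst query_diff) (auto intro!: signed_measurable simp: mult.left_commute)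
  with assms show ?thesis
    by (auto simp: evasive_def detected_def abs_mult)
qed

lemma null_oracle: "last_oracle null_mean \<in> sq_oracles d (rcn_half d) \<tau>"
  using tau_pos by (intro last_oracle_admissible)
    (auto simp: null_mean_def[abs_def] intro: measurable_query_mean rcn_half_in_distributions)

lemma evasive_oracle:
  assumes "v \<in> V" "\<bar>s\<bar> = 1"
  shows "last_oracle (evasive s v) \<in> sq_oracles d (signed s v) \<tau>"
proof (rule last_oracle_admissible)
  have [measurable]: "(\<lambda>q. \<integral>z. q z \<partial>signed s v) \<in> borel_measurable (query_space d)"
    using assms by (intro measurable_query_mean signed_in_distributions) auto
  have [measurable]: "null_mean \<in> borel_measurable (query_space d)"
    unfolding null_mean_def[abs_def] by (intro measurable_query_mean rcn_half_in_distributions)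
  show "evasive s v \<in> borel_measurable (query_space d)"
    unfolding evasive_def[abs_def] by measurable
qed (use tau_pos in \<open>auto simp: evasive_def\<close>)

text \<open>The path is the one under null answers, hence fixed before any index is chosen. For an
  index outside this set the evasive oracle never makes the run leave that path.\<close>

definition exposed :: "(query, 'r) sq_tree \<Rightarrow> 'v set" where
  "exposed t = (\<Union>q\<in>set (sq_path t null_mean). detected q)"

lemma exposed_subset: "exposed t \<subseteq> V"
  by (auto simp: exposed_def detected_def)

lemma card_exposed:
  assumes "asked t \<subseteq> queries d" "sq_count t (last_oracle null_mean) [] \<le> m"
  shows "real (card (exposed t)) \<le> m * (2 / \<tau>\<^sup>2)"
proof -
  let ?Q = "set (sq_path t null_mean)"
  have "real (card (exposed t)) \<le> (\<Sum>q\<in>?Q. real (card (detected q)))"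
    unfolding exposed_def of_nat_sum[symmetric] of_nat_le_iff by (rule card_UN_le) simp
  also have "\<dots> \<le> (\<Sum>q\<in>?Q. 2 / \<tau>\<^sup>2)"
    using set_sq_path[of t null_mean] assms(1) by (intro sum_mono card_detected) auto
  also have "\<dots> = card ?Q * (2 / \<tau>\<^sup>2)" by simp
  also have "\<dots> \<le> m * (2 / \<tau>\<^sup>2)"
    using assms(2) card_length[of "sq_path t null_mean"]
    by (intro mult_right_mono) (auto simp: sq_count_last_oracle)
  finally show ?thesis .
qed

lemma sq_run_evasive:
  assumes "asked t \<subseteq> queries d" "v \<in> V - exposed t" "\<bar>s\<bar> = 1"
  shows "sq_run t (last_oracle (evasive s v)) [] = sq_run t (last_oracle null_mean) []"
  using assms set_sq_path[of t null_mean]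
  by (intro sq_run_cong) (auto simp: exposed_def intro!: evasive_eq_null[symmetric])

text \<open>For every index the acceptance events with and without signal differ on a set of
  probability at least 1/3. For a fixed seed they can differ only at exposed indices, of which there
  are at most \<open>m * (2 / \<tau>\<^sup>2)\<close>. Averaging over the seed compares the two
  counts.\<close>

lemma distinguisher_lower_bound:
  assumes alg: "sq_algorithm d M A"
    and cnt: "makes_at_most d (insert (rcn_half d) \<D>) \<tau> M A m"
    and dst: "distinguishes d (rcn_half d) \<D> (1/3) \<tau> M A"
    and mem: "\<And>v. v \<in> V \<Longrightarrow> labelled d (f v) \<in> \<D>"
  shows "card V * \<tau>\<^sup>2 \<le> 6 * real m"
proof -
  interpret M: prob_space M using alg by (simp add: sq_algorithm_def)
  have mem': "signed 1 v \<in> \<D>" if "v \<in> V" for v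
    using mem[OF that] by (simp add: signed_def)
  define E0 where "E0 = out_event M A (last_oracle null_mean) (\<lambda>r. r = 1)"
  define E where "E v = out_event M A (last_oracle (evasive 1 v)) (\<lambda>r. r = 1)" for v
  have E0: "E0 \<in> sets M"
    using dst null_oracle unfolding distinguishes_def E0_def by blast
  have E: "E v \<in> sets M" if "v \<in> V" for v
    using dst evasive_oracle[OF that, of 1] mem'[OF that] unfolding distinguishes_def E_def by auto
  \<comment> \<open>Passing from a difference of probabilities to the symmetric difference of events
    makes a count per seed possible.\<close>
  have gap: "1/3 \<le> measure M ((E0 - E v) \<union> (E v - E0))" if "v \<in> V" for v
  proof -
    have "1/3 \<le> \<bar>measure M E0 - measure M (E v)\<bar>"
      using dst evasive_oracle[OF that, of 1] null_oracle mem'[OF that]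
      unfolding distinguishes_def E0_def E_def by auto
    moreover have "measure M E0 \<le> measure M (E v) + measure M ((E0 - E v) \<union> (E v - E0))"
      using E0 E[OF that] by (intro order.trans[OF M.finite_measure_mono measure_Un_le]) auto
    moreover have "measure M (E v) \<le> measure M E0 + measure M ((E0 - E v) \<union> (E v - E0))"
      using E0 E[OF that] by (intro order.trans[OF M.finite_measure_mono measure_Un_le]) auto
    ultimately show ?thesis by linarith
  qed
  have "card V * (1/3) = (\<Sum>v\<in>V. 1/3::real)" by simp
  also have "\<dots> \<le> (\<Sum>v\<in>V. measure M ((E0 - E v) \<union> (E v - E0)))"
    by (intro sum_mono gap)
  also have "\<dots> \<le> m * (2 / \<tau>\<^sup>2)"
  proof (rule sum_measure_le[OF M.prob_space_axioms finite_V])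
    fix \<omega> assume \<omega>: "\<omega> \<in> space M"
    have ask: "asked (A \<omega>) \<subseteq> queries d" using alg \<omega> by (simp add: sq_algorithm_def)
    have "(\<omega> \<in> E v) = (\<omega> \<in> E0)" if "v \<in> V - exposed (A \<omega>)" for v
      using sq_run_evasive[OF ask that, of 1] by (simp add: E0_def E_def out_event_def)
    then have "{v \<in> V. \<omega> \<in> (E0 - E v) \<union> (E v - E0)} \<subseteq> exposed (A \<omega>)"
      by blast
    then have "card {v \<in> V. \<omega> \<in> (E0 - E v) \<union> (E v - E0)} \<le> card (exposed (A \<omega>))"
      using finite_subset[OF exposed_subset finite_V] by (intro card_mono)
    also have "real \<dots> \<le> m * (2 / \<tau>\<^sup>2)"
      using cnt null_oracle \<omega> by (intro card_exposed ask) (auto simp: makes_at_most_def)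
    finally show "real (card {v \<in> V. \<omega> \<in> (E0 - E v) \<union> (E v - E0)}) \<le> m * (2 / \<tau>\<^sup>2)"
      by simp
  qed (use E0 E in auto)
  finally show ?thesis using tau_pos by (simp add: field_simps)
qed

text \<open>
  A hypothesis that beats \<open>1/2\<close> for \<open>f v\<close> fails for \<open>- f v\<close>. So a run that exposes few indices
  can succeed for at most about half of the signed distributions, while soundness and completeness
  together demand two thirds.
\<close>

lemma learner_lower_bound:
  assumes alg: "sq_algorithm d M L"
    and cnt: "makes_at_most d (distributions d) \<tau> M L m"
    and lrn: "testable_learner d H (rcn_half d) \<epsilon> \<delta> \<tau> M L" and \<delta>: "\<delta> \<le> 1/6"
    and opt: "\<And>v s. v \<in> V \<Longrightarrow> \<bar>s\<bar> = 1 \<Longrightarrow> opt_err H (labelled d (\<lambda>x. s * f v x)) + \<epsilon> < 1/2"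
  shows "card V * \<tau>\<^sup>2 \<le> 6 * real m"
proof -
  interpret M: prob_space M using alg by (simp add: sq_algorithm_def)
  define E0 where "E0 = out_event M L (last_oracle null_mean) (\<lambda>r. r \<noteq> Reject)"
  define E where "E v s = out_event M L (last_oracle (evasive s v))
    (\<lambda>r. \<forall>h. r = Accept h \<longrightarrow> err (signed s v) h \<le> opt_err H (signed s v) + \<epsilon>)" for v s
  define I where "I = V \<times> {1, -1 :: real}"
  have E0: "E0 \<in> sets M" "measure M E0 \<ge> 1 - \<delta>"
    using lrn null_oracle unfolding testable_learner_def E0_def Let_def by blast+
  have E: "E v s \<in> sets M" "measure M (E v s) \<ge> 1 - \<delta>" if "v \<in> V" "\<bar>s\<bar> = 1" for v s
    using lrn evasive_oracle[OF that] signed_in_distributions[of v s] that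
    unfolding testable_learner_def E_def Let_def by auto
  \<comment> \<open>Two events of probability at least 5/6 each. \<open>E0\<close> is acceptance
    under pure noise, so soundness and completeness are tied to the same seed.\<close>
  have both: "2/3 \<le> measure M (E v s \<inter> E0)" if "v \<in> V" "\<bar>s\<bar> = 1" for v s
  proof -
    have "measure M (E v s \<union> E0) = measure M (E v s) + measure M (E0 - E v s)"
      using E[OF that] E0 by (intro M.finite_measure_Union') auto
    moreover have "measure M (E0 - E v s) = measure M E0 - measure M (E v s \<inter> E0)"
      using E[OF that] E0 by (simp add: M.finite_measure_Diff' Int_commute)
    ultimately show ?thesis
      using M.prob_le_1[of "E v s \<union> E0"] E[OF that] E0 \<delta> by linarith
  qed
  \<comment> \<open>The \<open>2 * card V\<close> signed indices contribute 2/3 each. The count per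
    seed is \<open>card V\<close> plus the number of exposed indices, so the latter must make up for
    \<open>card V / 3\<close>.\<close>
  have "card V * (4/3) = (\<Sum>i\<in>I. 2/3::real)"
    using finite_V by (simp add: I_def card_cartesian_product)
  also have "\<dots> \<le> (\<Sum>i\<in>I. measure M (E (fst i) (snd i) \<inter> E0))"
    by (intro sum_mono both) (auto simp: I_def)
  also have "\<dots> \<le> card V + m * (2 / \<tau>\<^sup>2)"
  proof (rule sum_measure_le[OF M.prob_space_axioms])
    fix \<omega> assume \<omega>: "\<omega> \<in> space M"
    define X where "X = exposed (L \<omega>)"
    have X: "X \<subseteq> V" "finite X"
      unfolding X_def using exposed_subset finite_subset[OF exposed_subset finite_V] by auto
    have ask: "asked (L \<omega>) \<subseteq> queries d" using alg \<omega> by (simp add: sq_algorithm_def)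
    define G where "G = {i \<in> I. \<omega> \<in> E (fst i) (snd i) \<inter> E0}"
    \<comment> \<open>Outside \<open>X\<close> the accepted hypothesis is the same for both signs,
      so at most one sign of each such index is good. Indices in \<open>X\<close> may contribute
      both.\<close>
    have "inj_on fst (G - X \<times> {1, -1})"
    proof (rule ccontr)
      assume "\<not> inj_on fst (G - X \<times> {1, -1})"
      then obtain v where v: "v \<in> V - X" and good: "\<omega> \<in> E v 1" "\<omega> \<in> E v (-1)" "\<omega> \<in> E0"
        unfolding inj_on_def G_def I_def by fastforce
      define r where "r = sq_run (L \<omega>) (last_oracle null_mean) []"
      have r: "sq_run (L \<omega>) (last_oracle (evasive s v)) [] = r" if "\<bar>s\<bar> = 1" for s
        unfolding r_def using v that by (intro sq_run_evasive[OF ask]) (auto simp: X_def)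
      have "r \<in> insert Reject (Accept ` hypotheses d)"
        using sq_run_in_outputs[of "L \<omega>"] lrn \<omega> unfolding testable_learner_def r_def by blast
      with good(3) obtain h where h: "h \<in> hypotheses d" "r = Accept h"
        by (auto simp: E0_def out_event_def r_def)
      have pos: "0 < s * (\<integral>x. h x * f v x \<partial>std_gaussian d)" if "\<bar>s\<bar> = 1" "\<omega> \<in> E v s" for s
      proof -
        have "err (signed s v) h \<le> opt_err H (signed s v) + \<epsilon>"
          using that r[OF that(1)] h by (auto simp: E_def out_event_def)
        also have "\<dots> < 1/2" using opt[of v s] v that unfolding signed_def by auto
        also have "err (signed s v) h = 1/2 - (\<integral>x. h x * (s * f v x) \<partial>std_gaussian d) / 2"
          unfolding signed_def using v that h by (intro err_labelled signed_measurable) auto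
        finally show ?thesis by (simp add: mult.left_commute)
      qed
      from pos[of 1] pos[of "-1"] good show False by simp
    qed
    then have "card (G - X \<times> {1, -1}) = card (fst ` (G - X \<times> {1, -1}))"
      by (simp add: card_image)
    also have "\<dots> \<le> card (V - X)"
      using finite_V by (intro card_mono) (auto simp: G_def I_def)
    also have "\<dots> = card V - card X" using X by (intro card_Diff_subset)
    finally have "card G \<le> (card V - card X) + card (X \<times> {1, -1 :: real})"
      using X diff_card_le_card_Diff[of "X \<times> {1, -1 :: real}" G] by simp
    also have "card (X \<times> {1, -1 :: real}) = 2 * card X"
      by (simp add: card_cartesian_product)
    finally have "card G \<le> card V + card X"
      using card_mono[OF finite_V X(1)] by simp
    moreover have "real (card X) \<le> m * (2 / \<tau>\<^sup>2)"
      unfolding X_def using cnt null_oracle \<omega> rcn_half_in_distributions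
      by (intro card_exposed ask) (auto simp: makes_at_most_def)
    ultimately show "real (card {i \<in> I. \<omega> \<in> E (fst i) (snd i) \<inter> E0}) \<le> card V + m * (2 / \<tau>\<^sup>2)"
      unfolding G_def by linarith
  qed (use E0 E finite_V in \<open>auto simp: I_def\<close>)
  finally show ?thesis using tau_pos by (simp add: field_simps)
qed

end


section \<open>A bounded function with vanishing odd moments\<close>

text \<open>For odd \<open>k\<close>, \<open>M k\<close> is up to sign the mean of \<open>g\<close>
  times the \<open>k\<close>-th Hermite polynomial, because a wave of frequency \<open>b\<close>
  contributes \<open>b ^ k * exp (- (b\<^sup>2 / 2))\<close>. The series is Mehler's expansion for
  \<open>g\<close>, read off from the power series of \<open>sinh\<close>.\<close>

lemma integral_sine_sum_corr:
  fixes a b :: "'i \<Rightarrow> real"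
  assumes uv: "(\<Sum>i<d. (u i)\<^sup>2) = 1" "(\<Sum>i<d. (v i)\<^sup>2) = 1" and "finite I"
  defines "g \<equiv> \<lambda>x::real. \<Sum>i\<in>I. a i * sin (b i * x)"
    and "M \<equiv> \<lambda>k::nat. \<Sum>i\<in>I. a i * exp (- ((b i)\<^sup>2 / 2)) * b i ^ k"
  shows "(\<lambda>k. if even k then 0 else (\<Sum>i<d. u i * v i) ^ k / fact k * (M k)\<^sup>2) sums
    (\<integral>x. g (lin d u x) * g (lin d v x) \<partial>std_gaussian d)"
proof -
  interpret X: prob_space "std_gaussian d" by (rule prob_space_std_gaussian)
  define \<rho> where "\<rho> = (\<Sum>i<d. u i * v i)"
  define c where "c i = a i * exp (- ((b i)\<^sup>2 / 2))" for i
  have int: "integrable (std_gaussian d) (\<lambda>x. sin (b i * lin d u x) * sin (b j * lin d v x))" for i j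
    by (intro X.integrable_const_bound[where B=1] AE_I2) (auto simp: abs_mult intro!: mult_le_one)
  have "(\<integral>x. g (lin d u x) * g (lin d v x) \<partial>std_gaussian d)
    = (\<integral>x. (\<Sum>i\<in>I. \<Sum>j\<in>I. (a i * a j) * (sin (b i * lin d u x) * sin (b j * lin d v x))) \<partial>std_gaussian d)"
    unfolding g_def sum_product by (simp add: mult_ac)
  also have "\<dots> = (\<Sum>i\<in>I. \<Sum>j\<in>I. (a i * a j) *
      (\<integral>x. sin (b i * lin d u x) * sin (b j * lin d v x) \<partial>std_gaussian d))"
    using int by (simp add: Bochner_Integration.integral_sum)
  also have "\<dots> = (\<Sum>i\<in>I. \<Sum>j\<in>I. c i * c j * sinh (b i * b j * \<rho>))"
    unfolding integral_sin_sin_lin[OF uv] \<rho>_def[symmetric] by (simp add: c_def mult_ac)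
  finally have eq: "(\<integral>x. g (lin d u x) * g (lin d v x) \<partial>std_gaussian d)
    = (\<Sum>i\<in>I. \<Sum>j\<in>I. c i * c j * sinh (b i * b j * \<rho>))" .
  have "(\<lambda>k. \<Sum>i\<in>I. \<Sum>j\<in>I. c i * c j * (if even k then 0 else (b i * b j * \<rho>) ^ k /\<^sub>R fact k))
    sums (\<Sum>i\<in>I. \<Sum>j\<in>I. c i * c j * sinh (b i * b j * \<rho>))"
    by (intro sums_sum sums_mult sinh_converges)
  moreover have "(\<Sum>i\<in>I. \<Sum>j\<in>I. c i * c j * (if even k then 0 else (b i * b j * \<rho>) ^ k /\<^sub>R fact k))
    = (if even k then 0 else \<rho> ^ k / fact k * (M k)\<^sup>2)" for k
  proof (cases "even k")
    case False
    have "(M k)\<^sup>2 = (\<Sum>i\<in>I. \<Sum>j\<in>I. (c i * b i ^ k) * (c j * b j ^ k))"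
      by (simp only: M_def c_def power2_eq_square sum_product)
    then show ?thesis
      using False by (simp add: sum_distrib_left power_mult_distrib field_simps)
  qed simp
  ultimately show ?thesis unfolding eq \<rho>_def by simp
qed

text \<open>Termwise comparison with the case \<open>u = v\<close>: there all terms are non-negative
  and add up to the second moment of the sine sum, which is at most 1. The first surviving power of
  the inner product, \<open>2 * n + 1\<close>, can be taken out of every term.\<close>

lemma sine_sum_corr_bound:
  fixes a b :: "'i \<Rightarrow> real"
  assumes u: "(\<Sum>i<d. (u i)\<^sup>2) = 1" and v: "(\<Sum>i<d. (v i)\<^sup>2) = 1" and "finite I"
    and \<rho>: "\<bar>\<Sum>i<d. u i * v i\<bar> \<le> 1"
    and g: "\<And>x::real. \<bar>\<Sum>i\<in>I. a i * sin (b i * x)\<bar> \<le> 1"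
    and M: "\<And>l. l < n \<Longrightarrow> (\<Sum>i\<in>I. a i * exp (- ((b i)\<^sup>2 / 2)) * b i ^ (2 * l + 1)) = 0"
  shows "\<bar>\<integral>x. (\<Sum>i\<in>I. a i * sin (b i * lin d u x)) * (\<Sum>i\<in>I. a i * sin (b i * lin d v x)) \<partial>std_gaussian d\<bar>
    \<le> \<bar>\<Sum>i<d. u i * v i\<bar> ^ (2 * n + 1)"
proof -
  interpret X: prob_space "std_gaussian d" by (rule prob_space_std_gaussian)
  define \<rho> where "\<rho> = (\<Sum>i<d. u i * v i)"
  define G where "G x = (\<Sum>i\<in>I. a i * sin (b i * x))" for x
  define M where "M k = (\<Sum>i\<in>I. a i * exp (- ((b i)\<^sup>2 / 2)) * b i ^ k)" for k
  have [measurable]: "G \<in> borel_measurable borel"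
    unfolding G_def by measurable
  have GG: "G s * G t \<le> 1" for s t
    using mult_mono[OF g[of s] g[of t]] unfolding G_def[symmetric] by (simp add: abs_mult[symmetric])
  have S1: "(\<lambda>k. if even k then 0 else 1 / fact k * (M k)\<^sup>2) sums
      (\<integral>x. G (lin d v x) * G (lin d v x) \<partial>std_gaussian d)"
    using integral_sine_sum_corr[OF v v \<open>finite I\<close>, of a b] v
    unfolding G_def M_def by (simp add: power2_eq_square cong: if_cong)
  have S: "(\<lambda>k. if even k then 0 else \<rho> ^ k / fact k * (M k)\<^sup>2) sums
      (\<integral>x. G (lin d u x) * G (lin d v x) \<partial>std_gaussian d)"
    using integral_sine_sum_corr[OF u v \<open>finite I\<close>, of a b] unfolding G_def M_def \<rho>_def .
  have S2: "(\<lambda>k. \<bar>\<rho>\<bar> ^ (2 * n + 1) * (if even k then 0 else 1 / fact k * (M k)\<^sup>2)) sums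
      (\<bar>\<rho>\<bar> ^ (2 * n + 1) * (\<integral>x. G (lin d v x) * G (lin d v x) \<partial>std_gaussian d))"
    by (intro sums_mult S1)
  have le: "\<bar>if even k then 0 else \<rho> ^ k / fact k * (M k)\<^sup>2\<bar>
      \<le> \<bar>\<rho>\<bar> ^ (2 * n + 1) * (if even k then 0 else 1 / fact k * (M k)\<^sup>2)" for k
  proof (cases "even k")
    case False
    then obtain l where l: "k = 2 * l + 1" by (elim oddE)
    show ?thesis
    proof (cases "l < n")
      case True
      then have "M k = 0" using M unfolding M_def l by simp
      then show ?thesis by simp
    next
      case nl: False
      have "\<bar>\<rho>\<bar> ^ k \<le> \<bar>\<rho>\<bar> ^ (2 * n + 1)"
        using \<rho> nl unfolding \<rho>_def[symmetric] l by (intro power_decreasing) auto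
      then have "\<bar>\<rho>\<bar> ^ k * (1 / fact k * (M k)\<^sup>2) \<le> \<bar>\<rho>\<bar> ^ (2 * n + 1) * (1 / fact k * (M k)\<^sup>2)"
        by (intro mult_right_mono) auto
      then show ?thesis using False by (simp add: abs_mult power_abs)
    qed
  qed simp
  have "(\<integral>x. G (lin d u x) * G (lin d v x) \<partial>std_gaussian d)
      \<le> \<bar>\<rho>\<bar> ^ (2 * n + 1) * (\<integral>x. G (lin d v x) * G (lin d v x) \<partial>std_gaussian d)"
    using le by (intro sums_le[OF _ S S2]) (rule order.trans[OF abs_ge_self])
  moreover have "- (\<integral>x. G (lin d u x) * G (lin d v x) \<partial>std_gaussian d)
      \<le> \<bar>\<rho>\<bar> ^ (2 * n + 1) * (\<integral>x. G (lin d v x) * G (lin d v x) \<partial>std_gaussian d)"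
    using le by (intro sums_le[OF _ sums_minus[OF S] S2]) (rule order.trans[OF abs_ge_minus_self])
  moreover have "(\<integral>x. G (lin d v x) * G (lin d v x) \<partial>std_gaussian d) \<le> (\<integral>x. 1 \<partial>std_gaussian d)"
    using GG g unfolding G_def[symmetric]
    by (intro integral_mono X.integrable_const_bound[where B=1] AE_I2)
      (auto simp: abs_mult intro!: mult_le_one)
  then have "\<bar>\<rho>\<bar> ^ (2 * n + 1) * (\<integral>x. G (lin d v x) * G (lin d v x) \<partial>std_gaussian d)
      \<le> \<bar>\<rho>\<bar> ^ (2 * n + 1) * 1"
    by (intro mult_left_mono) (auto simp: X.prob_space)
  ultimately show ?thesis unfolding G_def \<rho>_def by linarith
qed

section \<open>Lagrange interpolation at the nodes 1 to n\<close>

definition lagrange_at :: "nat \<Rightarrow> real \<Rightarrow> nat \<Rightarrow> real" where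
  "lagrange_at n t i = (\<Prod>l\<in>{1..n} - {i}. (t - l) / (real i - real l))"

text \<open>Both sides are polynomials in \<open>t\<close> of degree below \<open>n\<close> that
  agree at the \<open>n\<close> nodes.\<close>

lemma lagrange_interpolation_power:
  assumes "l < n"
  shows "(\<Sum>i=1..n. lagrange_at n t i * real i ^ l) = t ^ l"
proof -
  define Q where "Q i = (\<Prod>l\<in>{1..n} - {i}. smult (1 / (real i - real l)) [:- real l, 1:])" for i
  have Q: "poly (Q i) t = lagrange_at n t i" for i t
    unfolding Q_def lagrange_at_def poly_prod by (intro prod.cong) (auto simp: diff_divide_distrib)
  have deg_Q: "degree (Q i) < n" if "i \<in> {1..n}" for i
  proof -
    have "degree (Q i) \<le> (\<Sum>l\<in>{1..n} - {i}. degree (smult (1 / (real i - real l)) [:- real l, 1:]))"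
      unfolding Q_def by (rule order.trans[OF degree_prod_sum_le]) (auto simp: o_def)
    also have "\<dots> \<le> (\<Sum>l\<in>{1..n} - {i}. 1)"
      by (intro sum_mono order.trans[OF degree_smult_le]) simp
    also have "\<dots> < n" using that by (simp add: card_Diff_subset)
    finally show ?thesis .
  qed
  have Q_at: "poly (Q i) (real j) = (if i = j then 1 else 0)" if "i \<in> {1..n}" "j \<in> {1..n}" for i j
  proof (cases "i = j")
    case True
    have "(\<Prod>l\<in>{1..n} - {i}. (real i - real l) / (real i - real l)) = (\<Prod>l\<in>{1..n} - {i}. 1)"
      by (intro prod.cong) auto
    then show ?thesis using True by (simp add: Q lagrange_at_def)
  next
    case False
    then show ?thesis using that by (auto simp: Q lagrange_at_def)
  qed
  have "(\<Sum>i=1..n. smult (real i ^ l) (Q i)) = monom 1 l"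
  proof (rule poly_eqI_degree[where A="real ` {1..n}"])
    fix x assume "x \<in> real ` {1..n}"
    then obtain j where j: "j \<in> {1..n}" "x = real j" by auto
    have "poly (\<Sum>i=1..n. smult (real i ^ l) (Q i)) x = (\<Sum>i=1..n. if i = j then real i ^ l else 0)"
      unfolding poly_sum using j by (intro sum.cong) (auto simp: Q_at)
    then show "poly (\<Sum>i=1..n. smult (real i ^ l) (Q i)) x = poly (monom 1 l) x"
      using j by (simp add: poly_monom)
  next
    have "degree (\<Sum>i=1..n. smult (real i ^ l) (Q i)) \<le> n - 1"
      using deg_Q by (intro degree_sum_le order.trans[OF degree_smult_le]) fastforce+
    then show "degree (\<Sum>i=1..n. smult (real i ^ l) (Q i)) < card (real ` {1..n})"
      using assms by (simp add: card_image)
    show "degree (monom (1::real) l) < card (real ` {1..n})"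
      using assms by (simp add: card_image degree_monom_eq)
  qed
  then have "poly (\<Sum>i=1..n. smult (real i ^ l) (Q i)) t = t ^ l"
    by (simp add: poly_monom)
  then show ?thesis by (simp add: poly_sum Q mult.commute)
qed

text \<open>The nodes to the left of \<open>i\<close> give one factorial, those to the right the
  other; the induction starts at \<open>n = i\<close> and adds nodes on the right.\<close>

lemma prod_node_gaps:
  assumes "1 \<le> i" "i \<le> n"
  shows "(\<Prod>l\<in>{1..n} - {i}. \<bar>real i - real l\<bar>) = fact (i - 1) * fact (n - i)"
  using assms(2)
proof (induction n rule: dec_induct)
  case base
  have "{1..i} - {i} = {1..<i}" by auto
  then have "(\<Prod>l\<in>{1..i} - {i}. \<bar>real i - real l\<bar>) = (\<Prod>l=1..<i. real (i - l))"
    by (auto intro!: prod.cong simp: of_nat_diff)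
  also have "\<dots> = (\<Prod>l=1..<i. real l)"
    by (subst prod.atLeastLessThan_rev) (auto intro!: prod.cong)
  also have "{1..<i} = {1..i - 1}" using assms(1) by auto
  finally show ?case by (simp add: fact_prod)
next
  case (step n)
  have "{1..Suc n} - {i} = insert (Suc n) ({1..n} - {i})" using step by auto
  then show ?case
    using step by (simp add: Suc_diff_le algebra_simps)
qed

lemma power_div_fact_le:
  assumes "c > 0" "y \<ge> 0"
  shows "(c * y) ^ k / fact k \<le> c ^ k * exp (y::real)"
proof -
  have "y ^ k / fact k \<le> exp y"
    using sum_le_suminf[OF sums_summable[OF exp_converges[of y]], of "{k}"] sums_unique[OF exp_converges[of y]]
      assms(2) by (simp add: field_simps)
  then show ?thesis using assms by (simp add: power_mult_distrib field_simps)
qed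

section \<open>Correlation of a fast sine wave with the sign\<close>

lemma sign_pm_measurable [measurable]: "sign_pm \<in> borel_measurable borel"
  unfolding sign_pm_def[abs_def] by measurable

lemma std_normal_density_deriv:
  "(std_normal_density has_real_derivative (- x * std_normal_density x)) (at x)"
  unfolding std_normal_density_def
  by (auto intro!: derivative_eq_intros simp: field_simps)

lemma std_normal_density_continuous [continuous_intros]: "isCont std_normal_density x"
  using DERIV_isCont[OF std_normal_density_deriv] .

lemma std_normal_density_0_ge: "std_normal_density 0 \<ge> 3/8"
proof -
  have "sqrt (2 * pi) \<le> sqrt ((8/3)\<^sup>2)"
    using pi_less_4 pi_approx by (intro real_sqrt_le_mono) (simp add: power2_eq_square)
  then have "1 / (8/3) \<le> 1 / sqrt (2 * pi)" by (intro divide_left_mono) auto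
  then show ?thesis by (simp add: std_normal_density_def)
qed

lemma integral_std_normal:
  fixes f :: "real \<Rightarrow> real"
  assumes [measurable]: "f \<in> borel_measurable borel"
  shows "(\<integral>z. f z \<partial>std_normal_distribution) = (\<integral>z. std_normal_density z * f z \<partial>lborel)"
  by (subst integral_density) (auto simp: normal_density_nonneg)

lemma integrable_density_poly: "integrable lborel (\<lambda>x. std_normal_density x * (1 + x\<^sup>2))"
  using integrable_normal_moment[where \<mu>=0 and \<sigma>=1 and k=0] integrable_normal_moment[where \<mu>=0 and \<sigma>=1 and k=2]
  by (simp add: distrib_left)

lemma integral_density_poly: "(\<integral>x. std_normal_density x * (1 + x\<^sup>2) \<partial>lborel) = 2"
  using integral_normal_moment_even[where \<mu>=0 and \<sigma>=1 and k=0]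
    integral_normal_moment_even[where \<mu>=0 and \<sigma>=1 and k=1]
    integrable_normal_moment[where \<mu>=0 and \<sigma>=1 and k=0] integrable_normal_moment[where \<mu>=0 and \<sigma>=1 and k=2]
  by (simp add: distrib_left power2_eq_square)

text \<open>Integration by parts on the half line leaves the boundary term
  \<open>std_normal_density 0 / b\<close>, caused by the jump of the sign at 0. Symmetry doubles it,
  and the remainder is of order \<open>1 / b\<^sup>2\<close>.\<close>

lemma integral_sin_sign_ge:
  assumes b: "b \<ge> 8"
  shows "(\<integral>z. sin (b * z) * sign_pm z \<partial>std_normal_distribution) \<ge> 1 / (2 * b)"
proof -
  let ?\<phi> = "std_normal_density"
  \<comment> \<open>The boundary terms of two integrations by parts: the cosine terms of the
    derivative cancel, so \<open>h\<close> differs from \<open>sin (b * x) * ?\<phi> x\<close> only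
    by a term with factor \<open>1 / b\<^sup>2\<close>. That term, multiplied by the sign, is
    \<open>k\<close>.\<close>
  define F where "F x = - cos (b * x) * ?\<phi> x / b - sin (b * x) * (x * ?\<phi> x) / b\<^sup>2" for x
  define h where "h x = sin (b * x) * ?\<phi> x * (1 - (1 - x\<^sup>2) / b\<^sup>2)" for x
  define k where "k x = sin (b * x) * sign_pm x * ?\<phi> x * (1 - x\<^sup>2) / b\<^sup>2" for x
  have hm [measurable]: "h \<in> borel_measurable borel" unfolding h_def by measurable
  have km [measurable]: "k \<in> borel_measurable borel" unfolding k_def by measurable
  have h_bd: "\<bar>h x\<bar> \<le> ?\<phi> x * (1 + x\<^sup>2)" for x
  proof -
    have "1 \<le> b\<^sup>2" using b by (simp add: self_le_power)
    then have "0 \<le> 1 / b\<^sup>2" "1 / b\<^sup>2 \<le> 1" "0 \<le> x\<^sup>2 / b\<^sup>2" "x\<^sup>2 / b\<^sup>2 \<le> x\<^sup>2"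
      by (auto simp: divide_le_eq mult_left_mono[of 1 "b\<^sup>2" "x\<^sup>2", simplified])
    then have "\<bar>1 - (1 - x\<^sup>2) / b\<^sup>2\<bar> \<le> 1 + x\<^sup>2"
      unfolding diff_divide_distrib by linarith
    then have "\<bar>sin (b * x)\<bar> * (?\<phi> x * \<bar>1 - (1 - x\<^sup>2) / b\<^sup>2\<bar>) \<le> 1 * (?\<phi> x * (1 + x\<^sup>2))"
      by (intro mult_mono) (auto simp: normal_density_nonneg)
    then show ?thesis by (simp add: h_def abs_mult normal_density_nonneg mult.assoc)
  qed
  have h_int: "integrable lborel h"
    by (rule Bochner_Integration.integrable_bound[OF integrable_density_poly])
      (use h_bd in \<open>auto simp: normal_density_nonneg intro!: AE_I2 order.trans[OF h_bd]\<close>)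
  have F_deriv: "(F has_real_derivative h x) (at x)" for x
    unfolding F_def h_def using b
    by (auto intro!: derivative_eq_intros std_normal_density_deriv simp: field_simps power2_eq_square)
  have F_inf: "(F \<longlongrightarrow> 0) at_top"
  proof -
    have "((\<lambda>x. ?\<phi> x / b + \<bar>x\<bar> * ?\<phi> x / b\<^sup>2) \<longlongrightarrow> 0) at_top"
  proof -
      have "((\<lambda>x::real. exp (- x\<^sup>2 / 2)) \<longlongrightarrow> 0) at_top" "((\<lambda>x::real. \<bar>x\<bar> * exp (- x\<^sup>2 / 2)) \<longlongrightarrow> 0) at_top"
        by real_asymp+
      then have "((\<lambda>x. 1 / sqrt (2 * pi) / b * exp (- x\<^sup>2 / 2)
          + 1 / sqrt (2 * pi) / b\<^sup>2 * (\<bar>x\<bar> * exp (- x\<^sup>2 / 2))) \<longlongrightarrow> 0) at_top"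
        by (intro tendsto_add_zero tendsto_mult_right_zero)
      then show ?thesis by (simp add: std_normal_density_def mult_ac)
    qed
    moreover have "\<bar>F x\<bar> \<le> ?\<phi> x / b + \<bar>x\<bar> * ?\<phi> x / b\<^sup>2" for x
    proof -
      have "\<bar>F x\<bar> \<le> \<bar>cos (b * x)\<bar> * (?\<phi> x / b) + \<bar>sin (b * x)\<bar> * (\<bar>x\<bar> * ?\<phi> x / b\<^sup>2)"
        unfolding F_def using b
        by (intro order.trans[OF abs_triangle_ineq4]) (auto simp: abs_mult normal_density_nonneg)
      also have "\<dots> \<le> 1 * (?\<phi> x / b) + 1 * (\<bar>x\<bar> * ?\<phi> x / b\<^sup>2)"
        using b by (intro add_mono mult_right_mono) (auto simp: normal_density_nonneg)
      finally show ?thesis by simp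
    qed
    ultimately show ?thesis by (intro Lim_null_comparison[where f=F]) auto
  qed
  have "(LBINT x=0..\<infinity>. h x) = 0 - F 0"
  proof (rule interval_integral_FTC_integrable)
    show "(F has_vector_derivative h x) (at x)" for x
      using F_deriv by (simp add: has_real_derivative_iff_has_vector_derivative)
    show "isCont h x" for x
      unfolding h_def using b by (intro continuous_intros) auto
    show "set_integrable lborel (einterval 0 \<infinity>) h"
      unfolding set_integrable_def using integrable_mult_indicator[OF _ h_int] by auto
    have "F \<midarrow>0\<rightarrow> F 0" using DERIV_isCont[OF F_deriv] by (simp add: isCont_def)
    then show "((F \<circ> real_of_ereal) \<longlongrightarrow> F 0) (at_right 0)"
      using filterlim_at_split[of F "nhds (F 0)" 0] by (simp add: ereal_tendsto_simps zero_ereal_def)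
    show "((F \<circ> real_of_ereal) \<longlongrightarrow> 0) (at_left \<infinity>)"
      using F_inf by (simp add: ereal_tendsto_simps)
  qed simp
  then have half: "(\<integral>x. indicator {0..} x *\<^sub>R h x \<partial>lborel) = ?\<phi> 0 / b"
  proof -
    assume "(LBINT x=0..\<infinity>. h x) = 0 - F 0"
    moreover have "(LBINT x=0..\<infinity>. h x) = (\<integral>x. indicator {0<..} x *\<^sub>R h x \<partial>lborel)"
      by (simp add: interval_integral_to_infinity_eq set_lebesgue_integral_def zero_ereal_def)
    moreover have "(\<integral>x. indicator {0<..} x *\<^sub>R h x \<partial>lborel) = (\<integral>x. indicator {0..} x *\<^sub>R h x \<partial>lborel)"
      by (intro Bochner_Integration.integral_cong refl) (auto simp: indicator_def h_def)
    ultimately show ?thesis by (simp add: F_def)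
  qed
  have "has_bochner_integral lborel (\<lambda>x. sign_pm x * h x) (2 *\<^sub>R (?\<phi> 0 / b))"
  proof (rule has_bochner_integral_even_function)
    have "integrable lborel (\<lambda>x. indicator {0..} x *\<^sub>R h x)"
      using integrable_mult_indicator[OF _ h_int] by auto
    then have "has_bochner_integral lborel (\<lambda>x. indicator {0..} x *\<^sub>R h x) (?\<phi> 0 / b)"
      using half by (simp add: has_bochner_integral_iff)
    then show "has_bochner_integral lborel (\<lambda>x. indicator {0..} x *\<^sub>R (sign_pm x * h x)) (?\<phi> 0 / b)"
      by (rule has_bochner_integral_cong[THEN iffD1, rotated -1]) (auto simp: indicator_def sign_pm_def)
    show "sign_pm (- x) * h (- x) = sign_pm x * h x" for x
      by (cases "x = 0") (auto simp: sign_pm_def h_def std_normal_density_def)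
  qed
  then have sh: "integrable lborel (\<lambda>x. sign_pm x * h x)" "(\<integral>x. sign_pm x * h x \<partial>lborel) = 2 * (?\<phi> 0 / b)"
    by (auto simp: has_bochner_integral_iff)
  have k_bd: "\<bar>k x\<bar> \<le> ?\<phi> x * (1 + x\<^sup>2) / b\<^sup>2" for x
  proof -
    have "\<bar>1 - x\<^sup>2\<bar> \<le> 1 + x\<^sup>2" by (auto simp: abs_le_iff)
    then have "\<bar>sin (b * x)\<bar> * (?\<phi> x * \<bar>1 - x\<^sup>2\<bar> / b\<^sup>2) \<le> 1 * (?\<phi> x * (1 + x\<^sup>2) / b\<^sup>2)"
      by (intro mult_mono divide_right_mono) (auto simp: normal_density_nonneg)
    then show ?thesis by (simp add: k_def abs_mult normal_density_nonneg mult.assoc sign_pm_def)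
  qed
  have pb: "integrable lborel (\<lambda>x. ?\<phi> x * (1 + x\<^sup>2) / b\<^sup>2)"
    using integrable_density_poly by (rule integrable_divide)
  have k_int: "integrable lborel k"
    by (rule Bochner_Integration.integrable_bound[OF pb])
      (auto simp: normal_density_nonneg intro!: AE_I2 order.trans[OF k_bd])
  have "(\<integral>x. - (?\<phi> x * (1 + x\<^sup>2) / b\<^sup>2) \<partial>lborel) \<le> (\<integral>x. k x \<partial>lborel)"
    using k_bd by (intro integral_mono integrable_minus pb k_int) (metis abs_le_iff minus_le_iff)
  then have k_ge: "- 2 / b\<^sup>2 \<le> (\<integral>x. k x \<partial>lborel)"
    by (simp add: integral_density_poly)
  have "(\<integral>z. sin (b * z) * sign_pm z \<partial>std_normal_distribution)
    = (\<integral>z. ?\<phi> z * (sin (b * z) * sign_pm z) \<partial>lborel)"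
    by (rule integral_std_normal) measurable
  also have "\<dots> = (\<integral>x. sign_pm x * h x + k x \<partial>lborel)"
    by (intro Bochner_Integration.integral_cong refl) (simp add: h_def k_def field_simps)
  also have "\<dots> = 2 * (?\<phi> 0 / b) + (\<integral>x. k x \<partial>lborel)"
    using sh k_int by simp
  also have "\<dots> \<ge> 2 * (?\<phi> 0 / b) - 2 / b\<^sup>2" using k_ge by simp
  moreover have "2 * (?\<phi> 0 / b) \<ge> 2 * ((3/8) / b)"
    using std_normal_density_0_ge b by (intro mult_left_mono divide_right_mono) auto
  \<comment> \<open>The main term is at least \<open>3 / (4 * b)\<close>, and
    \<open>2 / b\<^sup>2\<close> is at most \<open>1 / (4 * b)\<close> exactly when
    \<open>b \<ge> 8\<close>.\<close>
  moreover have "2 * ((3/8) / b) - 2 / b\<^sup>2 \<ge> 1 / (2 * b)"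
    using b by (simp add: field_simps power2_eq_square)
  ultimately show ?thesis by linarith
qed

text \<open>Every factor of the numerator is at most \<open>c * n\<close>. Splitting these factors
  into \<open>i - 1\<close> and \<open>n - i\<close> pairs each group with its factorial, and
  \<open>n ^ k / fact k\<close> is a term of the series of \<open>exp n\<close>.\<close>

lemma abs_lagrange_at_le:
  assumes i: "i \<in> {1..n}" and c: "c \<ge> 1"
  shows "\<bar>lagrange_at n (c * n) i\<bar> \<le> c ^ (n - 1) * exp (2 * real n)"
proof -
  have "\<bar>lagrange_at n (c * n) i\<bar>
      = (\<Prod>l\<in>{1..n} - {i}. \<bar>c * n - l\<bar>) / (fact (i - 1) * fact (n - i))"
    using i prod_node_gaps[of i n]
    by (simp add: lagrange_at_def abs_prod abs_divide prod_dividef)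
  also have "\<dots> \<le> (\<Prod>l\<in>{1..n} - {i}. c * n) / (fact (i - 1) * fact (n - i))"
  proof (intro divide_right_mono prod_mono conjI)
    fix l assume "l \<in> {1..n} - {i}"
    then have "real l \<le> 1 * real n" by simp
    also have "\<dots> \<le> c * n" using c by (intro mult_right_mono) auto
    finally show "\<bar>c * n - l\<bar> \<le> c * n" by simp
  qed auto
  also have "(\<Prod>l\<in>{1..n} - {i}. c * n) = (c * n) ^ (i - 1) * (c * n) ^ (n - i)"
    using i by (simp add: card_Diff_subset flip: power_add)
  also have "\<dots> / (fact (i - 1) * fact (n - i))
      = ((c * n) ^ (i - 1) / fact (i - 1)) * ((c * n) ^ (n - i) / fact (n - i))"
    by simp
  also have "\<dots> \<le> (c ^ (i - 1) * exp (real n)) * (c ^ (n - i) * exp (real n))"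
    using c by (intro mult_mono power_div_fact_le) auto
  also have "\<dots> = c ^ (n - 1) * exp (2 * real n)"
    using i by (simp add: algebra_simps flip: power_add exp_add)
  finally show ?thesis .
qed

text \<open>The Gaussian factors give \<open>exp (- (63 * n / 2))\<close>, while the Lagrange
  weights, the number of terms and the square roots together cost at most
  \<open>exp (10 * n)\<close>. The final factor \<open>sqrt (64 * n)\<close> is there because the
  weights must be small against the correlation of the main wave, of order
  \<open>1 / sqrt (64 * n)\<close>.\<close>

lemma correction_weight_bound:
  assumes n: "n \<ge> 1"
  shows "(\<Sum>i=1..n. \<bar>lagrange_at n (64 * n) i * exp (- ((64 * n - i) / 2)) * sqrt (64 * n / i)\<bar>) * sqrt (64 * n)
    \<le> 1 / 10"
proof -
  let ?T = "64 * real n"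
  have "(\<Sum>i=1..n. \<bar>lagrange_at n ?T i * exp (- ((?T - i) / 2)) * sqrt (?T / i)\<bar>) * sqrt ?T
    \<le> (\<Sum>i=1..n. (64 ^ (n - 1) * exp (2 * real n)) * exp (- (63 * real n / 2)) * sqrt ?T) * sqrt ?T"
  proof (intro mult_right_mono sum_mono)
    fix i assume i: "i \<in> {1..n}"
    have "sqrt (?T / i) \<le> sqrt ?T"
      using i by (intro real_sqrt_le_mono) (simp add: field_simps)
    moreover have "exp (- ((?T - i) / 2)) \<le> exp (- (63 * real n / 2))"
      using i by simp
    ultimately show "\<bar>lagrange_at n ?T i * exp (- ((?T - i) / 2)) * sqrt (?T / i)\<bar>
        \<le> (64 ^ (n - 1) * exp (2 * real n)) * exp (- (63 * real n / 2)) * sqrt ?T"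
      unfolding abs_mult using abs_lagrange_at_le[OF i, of 64] by (intro mult_mono) auto
  qed simp
  also have "\<dots> = 64 ^ (n - 1) * 64 * real n * real n * exp (2 * real n) * exp (- (63 * real n / 2))"
    by (simp add: algebra_simps)
  also have "(64::real) ^ (n - 1) * 64 = 64 ^ n"
    using n by (cases n) auto
  also have "64 ^ n * real n * real n * exp (2 * real n) * exp (- (63 * real n / 2))
    \<le> exp (6 * real n) * exp (real n) * exp (real n) * exp (2 * real n) * exp (- (63 * real n / 2))"
  proof (intro mult_mono)
    have "(2::real) ^ 6 \<le> exp 1 ^ 6" using exp_ge_add_one_self[of 1] by (intro power_mono) auto
    then have "(64::real) \<le> exp 6" by (simp flip: exp_of_nat_mult)
    then have "(64::real) ^ n \<le> exp 6 ^ n" by (intro power_mono) auto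
    then show "(64::real) ^ n \<le> exp (6 * real n)" by (simp add: mult.commute flip: exp_of_nat_mult)
    show "real n \<le> exp (real n)" "real n \<le> exp (real n)"
      using exp_ge_add_one_self[of "real n"] by linarith+
  qed auto
  also have "\<dots> = exp (- (43 * real n / 2))"
    by (simp flip: exp_add)
  also have "\<dots> \<le> exp (- 9)" using n by simp
  also have "\<dots> \<le> 1 / 10" using exp_ge_add_one_self[of 9] by (simp add: exp_minus field_simps)
  finally show ?thesis .
qed

text \<open>
  The main wave \<open>sin (8 \<surd>n x)\<close> correlates with the sign at the right order \<open>1/\<surd>n\<close>. Its first \<open>n\<close>
  odd moments are cancelled by waves \<open>sin (\<surd>i x)\<close>, \<open>1 \<le> i \<le> n\<close>: this is interpolation of the powers
  of \<open>64 n\<close> at the nodes \<open>i\<close>, and the weights are tiny because of the Gaussian factors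
  \<open>exp (- (64 n - i) / 2)\<close>.
\<close>

lemma exists_hard_function:
  assumes n: "n \<ge> 1"
  obtains g :: "real \<Rightarrow> real" where "g \<in> borel_measurable borel" "\<And>x. \<bar>g x\<bar> \<le> 1"
    "(\<integral>z. g z * sign_pm z \<partial>std_normal_distribution) \<ge> 1 / (40 * sqrt n)"
    "\<And>d u v. (\<Sum>i<d. (u i)\<^sup>2) = 1 \<Longrightarrow> (\<Sum>i<d. (v i)\<^sup>2) = 1 \<Longrightarrow> \<bar>\<Sum>i<d. u i * v i\<bar> \<le> 1 \<Longrightarrow>
      \<bar>\<integral>x. g (lin d u x) * g (lin d v x) \<partial>std_gaussian d\<bar> \<le> \<bar>\<Sum>i<d. u i * v i\<bar> ^ (2 * n + 1)"
proof -
  \<comment> \<open>\<open>sqrt T\<close> is the main frequency and must be at least 8 for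
    \<open>integral_sin_sign_ge\<close>. The gap \<open>T - i \<ge> 63 * n\<close> to the nodes
    supplies the Gaussian decay.\<close>
  define T where "T = 64 * real n"
  define b where "b i = sqrt (if i = 0 then T else real i)" for i :: nat
  \<comment> \<open>Index 0 is the main wave. The exponential replaces the Gaussian factor of node
    \<open>i\<close> by that of \<open>T\<close>, and \<open>sqrt (T / i)\<close> absorbs the odd
    half-power in \<open>b i ^ (2 * l + 1)\<close>, so plain interpolation of \<open>T ^ l\<close>
    remains. The factor 1/2 leaves room for the corrections within
    \<open>\<bar>g x\<bar> \<le> 1\<close>.\<close>
  define a where "a i = (if i = 0 then 1 / 2
    else - (1 / 2) * (lagrange_at n T i * exp (- ((T - i) / 2)) * sqrt (T / i)))" for i :: nat
  define g where "g x = (\<Sum>i=0..n. a i * sin (b i * x))" for x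
  define A where "A = (\<Sum>i=1..n. \<bar>a i\<bar>)"
  have T: "T \<ge> 64" "sqrt T = 8 * sqrt n"
    using n by (auto simp: T_def real_sqrt_mult)
  have sT: "sqrt T \<ge> 8" using real_sqrt_le_mono[OF T(1)] by simp
  have A: "A * sqrt T \<le> 1 / 20"
  proof -
    have "A = (\<Sum>i=1..n. 1 / 2 * \<bar>lagrange_at n T i * exp (- ((T - i) / 2)) * sqrt (T / i)\<bar>)"
      unfolding A_def by (intro sum.cong) (auto simp: a_def abs_mult)
    then have "A * sqrt T
        = 1 / 2 * ((\<Sum>i=1..n. \<bar>lagrange_at n T i * exp (- ((T - i) / 2)) * sqrt (T / i)\<bar>) * sqrt T)"
      unfolding mult.assoc[symmetric] sum_distrib_left by (simp only: mult.assoc)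
    then show ?thesis using correction_weight_bound[OF n] unfolding T_def by linarith
  qed
  have A0: "A \<ge> 0" unfolding A_def by (intro sum_nonneg) auto
  have A1: "A \<le> 1 / 2"
    using A mult_left_mono[OF sT A0] by linarith
  have split: "(\<Sum>i=0..n. h i) = h 0 + (\<Sum>i=1..n. h i)" for h :: "nat \<Rightarrow> real"
    by (simp add: sum.atLeast_Suc_atMost)
  have meas: "g \<in> borel_measurable borel" unfolding g_def by measurable
  have g1: "\<bar>g x\<bar> \<le> 1" for x
  proof -
    have "\<bar>g x\<bar> \<le> (\<Sum>i=0..n. \<bar>a i\<bar> * \<bar>sin (b i * x)\<bar>)"
      unfolding g_def by (rule order.trans[OF sum_abs]) (simp add: abs_mult)
    also have "\<dots> \<le> (\<Sum>i=0..n. \<bar>a i\<bar> * 1)" by (intro sum_mono mult_left_mono) auto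
    also have "\<dots> = 1 / 2 + A" by (simp add: split A_def) (simp add: a_def)
    finally show ?thesis using A1 by linarith
  qed
  have M: "(\<Sum>i=0..n. a i * exp (- ((b i)\<^sup>2 / 2)) * b i ^ (2 * l + 1)) = 0" if "l < n" for l
  proof -
    have pw: "sqrt x ^ (2 * l + 1) = sqrt x * x ^ l" if "x \<ge> 0" for x
      using that by (simp add: power_mult)
    have "a i * exp (- ((b i)\<^sup>2 / 2)) * b i ^ (2 * l + 1)
        = - (exp (- (T / 2)) * sqrt T / 2) * (lagrange_at n T i * real i ^ l)" if "i \<in> {1..n}" for i
    proof -
      have "a i * exp (- ((b i)\<^sup>2 / 2)) * b i ^ (2 * l + 1)
        = - (1 / 2) * lagrange_at n T i * (exp (- ((T - i) / 2)) * exp (- (real i / 2)))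
          * (sqrt (T / i) * sqrt i) * real i ^ l"
        using that pw[of "real i"] by (simp add: a_def b_def)
      also have "exp (- ((T - i) / 2)) * exp (- (real i / 2)) = exp (- (T / 2))"
        by (simp add: diff_divide_distrib flip: exp_add)
      also have "sqrt (T / i) * sqrt i = sqrt T"
        using that by (simp flip: real_sqrt_mult)
      finally show ?thesis by simp
    qed
    then have "(\<Sum>i=1..n. a i * exp (- ((b i)\<^sup>2 / 2)) * b i ^ (2 * l + 1))
        = - (exp (- (T / 2)) * sqrt T / 2) * (\<Sum>i=1..n. lagrange_at n T i * real i ^ l)"
      unfolding sum_distrib_left by (intro sum.cong) auto
    also have "\<dots> = - (exp (- (T / 2)) * sqrt T / 2) * T ^ l"
      by (simp only: lagrange_interpolation_power[OF that])
    also have "a 0 * exp (- ((b 0)\<^sup>2 / 2)) * b 0 ^ (2 * l + 1) = exp (- (T / 2)) * sqrt T / 2 * T ^ l"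
      using T(1) pw[of T] by (simp add: a_def b_def)
    ultimately show ?thesis unfolding split by simp
  qed
  have corr: "\<bar>\<integral>x. g (lin d u x) * g (lin d v x) \<partial>std_gaussian d\<bar> \<le> \<bar>\<Sum>i<d. u i * v i\<bar> ^ (2 * n + 1)"
    if "(\<Sum>i<d. (u i)\<^sup>2) = 1" "(\<Sum>i<d. (v i)\<^sup>2) = 1" "\<bar>\<Sum>i<d. u i * v i\<bar> \<le> 1" for d u v
    using sine_sum_corr_bound[OF that(1,2) _ that(3), of "{0..n}" a b n] g1 M unfolding g_def by simp
  interpret N: prob_space std_normal_distribution by (rule prob_space_normal_density) simp
  have int: "integrable std_normal_distribution (\<lambda>z. sin (c * z) * sign_pm z)" for c
    by (intro N.integrable_const_bound[where B=1] AE_I2) (auto simp: sign_pm_def)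
  have sin_le: "\<bar>\<integral>z. sin (c * z) * sign_pm z \<partial>std_normal_distribution\<bar> \<le> 1" for c
  proof -
    have "\<bar>\<integral>z. sin (c * z) * sign_pm z \<partial>std_normal_distribution\<bar>
        \<le> (\<integral>z. \<bar>sin (c * z) * sign_pm z\<bar> \<partial>std_normal_distribution)" by (rule integral_abs_bound)
    also have "\<dots> \<le> (\<integral>z. 1 \<partial>std_normal_distribution)"
      by (intro integral_mono integrable_abs int) (auto simp: sign_pm_def)
    finally show ?thesis using N.prob_space by simp
  qed
  have "(\<integral>z. g z * sign_pm z \<partial>std_normal_distribution)
      = (\<integral>z. (\<Sum>i=0..n. a i * (sin (b i * z) * sign_pm z)) \<partial>std_normal_distribution)"
    unfolding g_def sum_distrib_right by (simp add: mult.assoc)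
  also have "\<dots> = (\<Sum>i=0..n. a i * (\<integral>z. sin (b i * z) * sign_pm z \<partial>std_normal_distribution))"
    using int by (subst Bochner_Integration.integral_sum) auto
  also have "\<dots> = 1 / 2 * (\<integral>z. sin (sqrt T * z) * sign_pm z \<partial>std_normal_distribution)
      + (\<Sum>i=1..n. a i * (\<integral>z. sin (b i * z) * sign_pm z \<partial>std_normal_distribution))"
    unfolding split by (simp add: a_def b_def)
  also have "\<dots> \<ge> 1 / 2 * (1 / (2 * sqrt T)) - A"
  proof -
    have "- A \<le> (\<Sum>i=1..n. a i * (\<integral>z. sin (b i * z) * sign_pm z \<partial>std_normal_distribution))"
      unfolding A_def sum_negf[symmetric]
    proof (intro sum_mono)
      fix i
      have "\<bar>a i * (\<integral>z. sin (b i * z) * sign_pm z \<partial>std_normal_distribution)\<bar> \<le> \<bar>a i\<bar> * 1"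
        unfolding abs_mult by (intro mult_left_mono sin_le) auto
      then show "- \<bar>a i\<bar> \<le> a i * (\<integral>z. sin (b i * z) * sign_pm z \<partial>std_normal_distribution)"
        by linarith
    qed
    then show ?thesis using integral_sin_sign_ge[OF sT] by linarith
  qed
  moreover have "A \<le> 1 / (20 * sqrt T)"
  proof -
    have "0 < sqrt T" using sT by linarith
    then show ?thesis using A by (simp add: pos_le_divide_eq mult_ac)
  qed
  \<comment> \<open>\<open>1/4 - 1/20 = 1/5\<close>, and \<open>sqrt T = 8 * sqrt n\<close>.\<close>
  moreover have "1 / 2 * (1 / (2 * sqrt T)) - 1 / (20 * sqrt T) = 1 / (40 * sqrt n)"
    using n by (simp add: T(2) field_simps)
  ultimately have "(\<integral>z. g z * sign_pm z \<partial>std_normal_distribution) \<ge> 1 / (40 * sqrt n)"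
    by linarith
  from that[OF meas g1 this corr] show thesis .
qed


section \<open>Correlation of halfspaces\<close>

lemma distr_uminus_std_normal:
  "distr std_normal_distribution borel uminus = std_normal_distribution"
proof -
  \<comment> \<open>One linear form in dimension 1, whose variance is read both as
    \<open>(-1)\<^sup>2\<close> and as \<open>1\<^sup>2\<close>.\<close>
  have "distr std_normal_distribution borel (\<lambda>z. -1 * z) = distr std_normal_distribution borel (\<lambda>z. 1 * z)"
    using distr_lin[where d=1 and w="\<lambda>_. 1" and \<sigma>="-1"] distr_lin[where d=1 and w="\<lambda>_. 1" and \<sigma>=1]
    by simp
  also have "\<dots> = std_normal_distribution" by (simp add: distr_id2)
  finally show ?thesis by simp
qed

definition flip :: "nat \<Rightarrow> nat set \<Rightarrow> point \<Rightarrow> point" where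
  "flip d S x = (\<lambda>i\<in>{..<d}. if i \<in> S then - x i else x i)"

lemma measurable_flip [measurable]: "flip d S \<in> Rn d \<rightarrow>\<^sub>M Rn d"
proof -
  have [measurable]: "(\<lambda>x. x i) \<in> borel_measurable (Rn d)" if "i < d" for i
    unfolding Rn_def using that by (intro measurable_component_singleton) auto
  show ?thesis
    unfolding flip_def by (subst (2) Rn_def, intro measurable_restrict) auto
qed

lemma lin_flip: "lin d w (flip d S x) = lin d (\<lambda>i. if i \<in> S then - w i else w i) x"
  unfolding lin_def flip_def by (intro sum.cong) auto

lemma distr_flip: "distr (std_gaussian d) (Rn d) (flip d S) = std_gaussian d"
proof -
  interpret product_prob_space "\<lambda>_::nat. std_normal_distribution"
    by (rule product_prob_space_std_normal)
  have "distr (std_gaussian d) (Rn d) (flip d S) = (\<Pi>\<^sub>M i\<in>{..<d}. std_normal_distribution)"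
  proof (rule PiM_eqI)
    fix A :: "nat \<Rightarrow> real set" assume A: "\<And>i. i \<in> {..<d} \<Longrightarrow> A i \<in> sets std_normal_distribution"
    define B where "B i = (if i \<in> S then uminus -` A i else A i)" for i
    have B: "B i \<in> sets std_normal_distribution" if "i < d" for i
      using A[of i] that measurable_sets[of uminus borel borel "A i"] by (auto simp: B_def)
    have "flip d S -` Pi\<^sub>E {..<d} A \<inter> space (std_gaussian d) = Pi\<^sub>E {..<d} B"
    proof (rule set_eqI)
      fix x
      have "flip d S x \<in> Pi\<^sub>E {..<d} A \<longleftrightarrow> (\<forall>i<d. x i \<in> B i)"
        by (simp add: flip_def B_def PiE_iff) (metis lessThan_iff)
      then show "x \<in> flip d S -` Pi\<^sub>E {..<d} A \<inter> space (std_gaussian d) \<longleftrightarrow> x \<in> Pi\<^sub>E {..<d} B"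
        by (simp add: std_gaussian_def space_PiM PiE_iff Ball_def conj_commute)
    qed
    moreover have "Pi\<^sub>E {..<d} A \<in> sets (Rn d)"
      unfolding Rn_def using A by (intro sets_PiM_I_finite) auto
    ultimately have "emeasure (distr (std_gaussian d) (Rn d) (flip d S)) (Pi\<^sub>E {..<d} A)
        = emeasure (std_gaussian d) (Pi\<^sub>E {..<d} B)"
      by (subst emeasure_distr) auto
    also have "\<dots> = (\<Prod>i<d. emeasure std_normal_distribution (B i))"
      unfolding std_gaussian_def using B by (intro emeasure_PiM) auto
    also have "\<dots> = (\<Prod>i<d. emeasure std_normal_distribution (A i))"
    proof (intro prod.cong refl)
      fix i assume "i \<in> {..<d}"
      then have "A i \<in> sets borel" using A by auto
      then have "emeasure std_normal_distribution (uminus -` A i) = emeasure std_normal_distribution (A i)"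
        using emeasure_distr[of uminus std_normal_distribution borel "A i"]
        by (simp add: distr_uminus_std_normal)
      then show "emeasure std_normal_distribution (B i) = emeasure std_normal_distribution (A i)"
        by (simp add: B_def)
    qed
    finally show "emeasure (distr (std_gaussian d) (Rn d) (flip d S)) (Pi\<^sub>E {..<d} A)
      = (\<Prod>i<d. emeasure std_normal_distribution (A i))" .
  qed (simp_all, simp add: Rn_def cong: sets_PiM_cong)
  then show ?thesis by (simp add: std_gaussian_def)
qed

lemma integral_flip:
  fixes F :: "point \<Rightarrow> real"
  assumes "F \<in> borel_measurable (Rn d)"
  shows "(\<integral>x. F (flip d S x) \<partial>std_gaussian d) = (\<integral>x. F x \<partial>std_gaussian d)"
  using integral_distr[of "flip d S" "std_gaussian d" "Rn d" F] assms
  by (simp add: distr_flip)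

section \<open>Sign functions of nearly orthogonal linear forms\<close>

lemma integrable_lin:
  fixes f :: "real \<Rightarrow> real"
  assumes "(\<Sum>i<d. (w i)\<^sup>2) = \<sigma>\<^sup>2" and [measurable]: "f \<in> borel_measurable borel"
    and "integrable std_normal_distribution (\<lambda>z. f (\<sigma> * z))"
  shows "integrable (std_gaussian d) (\<lambda>x. f (lin d w x))"
proof -
  have "integrable (distr (std_gaussian d) borel (lin d w)) f"
    unfolding distr_lin[OF assms(1)] using assms(3) by (simp add: integrable_distr_eq)
  then show ?thesis by (simp add: integrable_distr_eq)
qed

lemma std_normal_density_le: "std_normal_density x \<le> 1 / 2"
proof -
  have "std_normal_density x = 1 / sqrt (2 * pi) * exp (- x\<^sup>2 / 2)"
    by (simp add: std_normal_density_def)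
  also have "\<dots> \<le> 1 / 2 * 1"
  proof (intro mult_mono)
    have "sqrt (2\<^sup>2) \<le> sqrt (2 * pi)" using pi_gt3 by (intro real_sqrt_le_mono) simp
    then show "1 / sqrt (2 * pi) \<le> 1 / 2" by (intro divide_left_mono) auto
  qed auto
  finally show ?thesis by simp
qed

lemma small_ball_std_normal:
  assumes "t \<ge> 0"
  shows "(\<integral>z. indicator {z. \<bar>z\<bar> \<le> t} z \<partial>std_normal_distribution) \<le> t"
proof -
  have eq: "{z. \<bar>z\<bar> \<le> t} = {- t..t}" by auto
  have "(\<integral>z. indicator {z. \<bar>z\<bar> \<le> t} z \<partial>std_normal_distribution)
    = (\<integral>z. std_normal_density z * indicator {- t..t} z \<partial>lborel)"
    unfolding eq by (rule integral_std_normal) measurable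
  also have "\<dots> \<le> (\<integral>z. 1 / 2 * indicator {- t..t} z \<partial>lborel)"
  proof (rule integral_mono)
    show "integrable lborel (\<lambda>z. std_normal_density z * indicator {- t..t} z)"
      by (rule integrable_real_mult_indicator) auto
    show "integrable lborel (\<lambda>z. 1 / 2 * indicator {- t..t} z :: real)"
      by (intro integrable_mult_right integrable_real_indicator) (auto simp: emeasure_lborel_Icc_eq)
    show "std_normal_density z * indicator {- t..t} z \<le> 1 / 2 * indicator {- t..t} z" for z
      by (intro mult_right_mono std_normal_density_le) simp
  qed
  also have "\<dots> = t" using assms by simp
  finally show ?thesis .
qed

text \<open>
  Flipping the coordinates in the support of \<open>w\<close> turns \<open>e + w\<close> into \<open>e - w\<close> and fixes \<open>u\<close>, so
  only points with \<open>\<bar>w \<bullet> x\<bar> \<le> \<bar>e \<bullet> x\<bar>\<close> contribute to the correlation.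
\<close>

lemma sgn_correlation_bound:
  assumes v: "(\<Sum>i<d. (v i)\<^sup>2) = 1"
    and \<delta>: "(\<Sum>i<d. if u i = 0 then 0 else (v i)\<^sup>2) \<le> \<delta>" "\<delta> \<le> 1 / 2" and s: "s > 0"
  shows "\<bar>\<integral>x. sgn (lin d u x) * sgn (lin d v x) \<partial>std_gaussian d\<bar> \<le> 2 * s + \<delta> / s\<^sup>2"
proof -
  interpret X: prob_space "std_gaussian d" by (rule prob_space_std_gaussian)
  interpret N: prob_space std_normal_distribution by (rule prob_space_normal_density) simp
  \<comment> \<open>\<open>e\<close> is the part of \<open>v\<close> on the support of
    \<open>u\<close>, of squared length at most \<delta>, and \<open>w\<close> is the rest.\<close>
  define e where "e i = (if u i = 0 then 0 else v i)" for i
  define w where "w i = (if u i = 0 then v i else 0)" for i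
  have v_eq: "lin d v x = lin d e x + lin d w x" for x
    unfolding lin_def sum.distrib[symmetric] by (intro sum.cong) (auto simp: e_def w_def)
  define \<sigma>e where "\<sigma>e = sqrt (\<Sum>i<d. (e i)\<^sup>2)"
  define \<sigma>w where "\<sigma>w = sqrt (\<Sum>i<d. (w i)\<^sup>2)"
  have \<sigma>e: "(\<Sum>i<d. (e i)\<^sup>2) = \<sigma>e\<^sup>2" and \<sigma>w: "(\<Sum>i<d. (w i)\<^sup>2) = \<sigma>w\<^sup>2" "\<sigma>w \<ge> 0"
    by (simp_all add: \<sigma>e_def \<sigma>w_def sum_nonneg)
  have "(\<Sum>i<d. (e i)\<^sup>2) = (\<Sum>i<d. if u i = 0 then 0 else (v i)\<^sup>2)"
    by (intro sum.cong) (auto simp: e_def)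
  then have e_le: "\<sigma>e\<^sup>2 \<le> \<delta>" using \<delta>(1) \<sigma>e by simp
  have "(\<Sum>i<d. (e i)\<^sup>2) + (\<Sum>i<d. (w i)\<^sup>2) = 1"
    unfolding v[symmetric] sum.distrib[symmetric] by (intro sum.cong) (auto simp: e_def w_def)
  then have "(1 / 2)\<^sup>2 \<le> \<sigma>w\<^sup>2" using e_le \<delta>(2) \<sigma>e \<sigma>w by (simp add: power2_eq_square)
  then have w_ge: "1 / 2 \<le> \<sigma>w" using \<sigma>w(2) by (rule power2_le_imp_le)
  define P where "P x = sgn (lin d u x) * sgn (lin d e x + lin d w x)" for x
  define Q where "Q x = sgn (lin d u x) * sgn (lin d e x - lin d w x)" for x
  \<comment> \<open>If \<open>\<bar>lin d w x\<bar> \<le> \<bar>lin d e x\<bar>\<close>, then either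
    the first is at most \<open>s\<close>, a small-ball event, or the second is at least
    \<open>s\<close>, which is rare by Chebyshev. \<open>R\<close> dominates both
    indicators.\<close>
  define R where "R x = indicator {z. \<bar>z\<bar> \<le> s} (lin d w x) + (lin d e x)\<^sup>2 / s\<^sup>2" for x
  have [measurable]: "P \<in> borel_measurable (Rn d)" "Q \<in> borel_measurable (Rn d)"
    unfolding P_def Q_def by measurable
  have P_int: "integrable (std_gaussian d) P" "integrable (std_gaussian d) Q"
    by (intro X.integrable_const_bound[where B=1] AE_I2; simp add: P_def Q_def abs_mult abs_sgn_eq)+
  have PQ: "(\<integral>x. Q x \<partial>std_gaussian d) = (\<integral>x. P x \<partial>std_gaussian d)"
  proof -
    have "P (flip d {i. w i \<noteq> 0} x) = Q x" for x
    proof -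
      have "lin d u (flip d {i. w i \<noteq> 0} x) = lin d u x" "lin d e (flip d {i. w i \<noteq> 0} x) = lin d e x"
        unfolding lin_flip unfolding lin_def by (intro sum.cong; auto simp: w_def e_def)+
      moreover have "lin d w (flip d {i. w i \<noteq> 0} x) = - lin d w x"
        unfolding lin_flip unfolding lin_def sum_negf[symmetric] by (intro sum.cong) (auto simp: w_def)
      ultimately show ?thesis by (simp add: P_def Q_def)
    qed
    then show ?thesis using integral_flip[of P d "{i. w i \<noteq> 0}"] by simp
  qed
  have z2: "integrable std_normal_distribution (\<lambda>z. z\<^sup>2)" "(\<integral>z. z\<^sup>2 \<partial>std_normal_distribution) = 1"
    using std_normal_distribution_even_moments[of 1] by (simp_all add: fact_numeral)
  have e2: "integrable (std_gaussian d) (\<lambda>x. (lin d e x)\<^sup>2)"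
    by (rule integrable_lin[OF \<sigma>e, where f="\<lambda>z. z\<^sup>2"]) (simp_all add: power_mult_distrib z2)
  have R1_int: "integrable (std_gaussian d) (\<lambda>x. indicat_real {z. \<bar>z\<bar> \<le> s} (lin d w x))"
    by (intro X.integrable_const_bound[where B=1] AE_I2) auto
  have R_int: "integrable (std_gaussian d) R"
    unfolding R_def using e2 R1_int by (intro Bochner_Integration.integrable_add integrable_divide)
  have PR: "\<bar>P x + Q x\<bar> \<le> 2 * R x" for x
  proof (cases "\<bar>lin d e x\<bar> < \<bar>lin d w x\<bar>")
    case True
    then have "sgn (lin d e x + lin d w x) + sgn (lin d e x - lin d w x) = 0"
      by (auto simp: sgn_if abs_if split: if_splits)
    then have "P x + Q x = 0" unfolding P_def Q_def distrib_left[symmetric] by simp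
    then show ?thesis by (simp add: R_def)
  next
    case False
    have "1 \<le> R x"
    proof (cases "\<bar>lin d w x\<bar> \<le> s")
      case True
      then show ?thesis by (simp add: R_def)
    next
      case nle: False
      with False have "s \<le> \<bar>lin d e x\<bar>" by simp
      with s have "s\<^sup>2 \<le> (lin d e x)\<^sup>2" by (metis abs_le_square_iff abs_of_pos)
      then show ?thesis using nle s by (simp add: R_def)
    qed
    moreover have "\<bar>P x\<bar> \<le> 1" "\<bar>Q x\<bar> \<le> 1" by (auto simp: P_def Q_def abs_mult abs_sgn_eq)
    ultimately show ?thesis by linarith
  qed
  have "2 * \<bar>\<integral>x. P x \<partial>std_gaussian d\<bar> = \<bar>\<integral>x. P x + Q x \<partial>std_gaussian d\<bar>"
    using P_int PQ by simp
  also have "\<dots> \<le> (\<integral>x. \<bar>P x + Q x\<bar> \<partial>std_gaussian d)" by (rule integral_abs_bound)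
  also have "\<dots> \<le> (\<integral>x. 2 * R x \<partial>std_gaussian d)"
    using P_int R_int PR by (intro integral_mono) auto
  also have "\<dots> = 2 * (\<integral>x. R x \<partial>std_gaussian d)" by simp
  finally have "\<bar>\<integral>x. P x \<partial>std_gaussian d\<bar> \<le> (\<integral>x. R x \<partial>std_gaussian d)" by simp
  also have "\<dots> = (\<integral>x. indicat_real {z. \<bar>z\<bar> \<le> s} (lin d w x) \<partial>std_gaussian d)
      + (\<integral>x. (lin d e x)\<^sup>2 \<partial>std_gaussian d) / s\<^sup>2"
    unfolding R_def using e2 R1_int by simp
  also have "(\<integral>x. (lin d e x)\<^sup>2 \<partial>std_gaussian d) = \<sigma>e\<^sup>2"
    by (subst integral_lin[OF \<sigma>e, where f="\<lambda>z. z\<^sup>2"]) (simp_all add: power_mult_distrib z2)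
  also have "(\<integral>x. indicat_real {z. \<bar>z\<bar> \<le> s} (lin d w x) \<partial>std_gaussian d)
      = (\<integral>z. indicat_real {z. \<bar>z\<bar> \<le> s} (\<sigma>w * z) \<partial>std_normal_distribution)"
    by (rule integral_lin[OF \<sigma>w(1)]) measurable
  \<comment> \<open>The length of \<open>w\<close> is at least 1/2, which at most doubles the
    ball.\<close>
  also have "\<dots> \<le> (\<integral>z. indicat_real {z. \<bar>z\<bar> \<le> 2 * s} z \<partial>std_normal_distribution)"
  proof (intro integral_mono N.integrable_const_bound[where B=1] AE_I2)
    fix z
    have "\<bar>z\<bar> \<le> 2 * s" if "\<bar>\<sigma>w * z\<bar> \<le> s"
      using that mult_right_mono[OF w_ge, of "\<bar>z\<bar>"] \<sigma>w(2) by (simp add: abs_mult)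
    then show "indicat_real {z. \<bar>z\<bar> \<le> s} (\<sigma>w * z) \<le> indicat_real {z. \<bar>z\<bar> \<le> 2 * s} z"
      by (auto simp: indicator_def)
  qed (auto, measurable)
  also have "\<dots> \<le> 2 * s" using s by (intro small_ball_std_normal) simp
  finally have "\<bar>\<integral>x. P x \<partial>std_gaussian d\<bar> \<le> 2 * s + \<sigma>e\<^sup>2 / s\<^sup>2" by simp
  also have "\<dots> \<le> 2 * s + \<delta> / s\<^sup>2" using e_le s by (intro add_left_mono divide_right_mono) auto
  finally show ?thesis unfolding P_def v_eq .
qed

lemma integral_sgn_sign_pm: "(\<integral>z. sgn z * sign_pm z \<partial>std_normal_distribution) = 1"
proof -
  interpret N: prob_space std_normal_distribution by (rule prob_space_normal_density) simp
  have "AE z in lborel. z \<noteq> (0::real)" by (rule AE_lborel_singleton)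
  then have "AE z in std_normal_distribution. sgn z * sign_pm z = 1"
    by (subst AE_density) (auto simp: sign_pm_def)
  then have "(\<integral>z. sgn z * sign_pm z \<partial>std_normal_distribution) = (\<integral>z. 1 \<partial>std_normal_distribution)"
    by (intro integral_cong_AE) auto
  then show ?thesis using N.prob_space by simp
qed


section \<open>Nearly orthogonal directions\<close>

text \<open>\<open>n\<close> minus the Hamming distance, for words of length \<open>n\<close> over
  an alphabet of \<open>n\<close> letters.\<close>

definition agreement :: "nat \<Rightarrow> (nat \<Rightarrow> nat) \<Rightarrow> (nat \<Rightarrow> nat) \<Rightarrow> nat" where
  "agreement n f g = card {a \<in> {..<n}. f a = g a}"

text \<open>Union bound over the \<open>r\<close>-element sets of positions on which
  \<open>g\<close> copies \<open>f\<close>; the other positions are free.\<close>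

lemma card_agreement_ball:
  assumes f: "f \<in> {..<n} \<rightarrow>\<^sub>E {..<n}" and "r \<le> n"
  shows "card {g \<in> {..<n} \<rightarrow>\<^sub>E {..<n}. r \<le> agreement n f g} \<le> (n choose r) * n ^ (n - r)"
proof -
  define C where "C S = {g \<in> {..<n} \<rightarrow>\<^sub>E {..<n}. \<forall>a\<in>S. g a = f a}" for S
  define \<S> where "\<S> = {S. S \<subseteq> {..<n} \<and> card S = r}"
  have fin: "finite \<S>" unfolding \<S>_def by (rule finite_subset[of _ "Pow {..<n}"]) auto
  have "{g \<in> {..<n} \<rightarrow>\<^sub>E {..<n}. r \<le> agreement n f g} \<subseteq> (\<Union>S\<in>\<S>. C S)"
  proof
    fix g assume g: "g \<in> {g \<in> {..<n} \<rightarrow>\<^sub>E {..<n}. r \<le> agreement n f g}"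
    then have "r \<le> card {a \<in> {..<n}. f a = g a}" by (simp add: agreement_def)
    then obtain S where S: "S \<subseteq> {a \<in> {..<n}. f a = g a}" "card S = r"
      by (rule obtain_subset_with_card_n)
    then have "S \<in> \<S>" "g \<in> C S" using g by (auto simp: \<S>_def C_def)
    then show "g \<in> (\<Union>S\<in>\<S>. C S)" by blast
  qed
  then have "card {g \<in> {..<n} \<rightarrow>\<^sub>E {..<n}. r \<le> agreement n f g} \<le> card (\<Union>S\<in>\<S>. C S)"
    by (intro card_mono finite_UN_I fin finite_subset[of "C _" "{..<n} \<rightarrow>\<^sub>E {..<n}"] finite_PiE)
      (auto simp: C_def)
  also have "\<dots> \<le> (\<Sum>S\<in>\<S>. card (C S))" by (rule card_UN_le[OF fin])
  also have "\<dots> = (\<Sum>S\<in>\<S>. n ^ (n - r))"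
  proof (intro sum.cong refl)
    fix S assume S: "S \<in> \<S>"
    have "C S = PiE {..<n} (\<lambda>a. if a \<in> S then {f a} else {..<n})"
    proof (rule set_eqI)
      fix g
      have "f a < n" if "a < n" for a using f that by auto
      moreover have "a < n" if "a \<in> S" for a using S that by (auto simp: \<S>_def)
      ultimately show "g \<in> C S \<longleftrightarrow> g \<in> PiE {..<n} (\<lambda>a. if a \<in> S then {f a} else {..<n})"
        unfolding C_def PiE_iff by (simp split: if_splits) (metis lessThan_iff singletonD singletonI)
    qed
    then have "card (C S) = (\<Prod>a<n. if a \<in> S then 1 else n)"
      by (simp add: card_PiE if_distrib cong: if_cong)
    also have "\<dots> = (\<Prod>a\<in>{..<n} - S. n)"
      using S by (intro prod.mono_neutral_cong_right) (auto simp: \<S>_def)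
    also have "\<dots> = n ^ (n - r)"
      using S by (auto simp: \<S>_def card_Diff_subset finite_subset)
    finally show "card (C S) = n ^ (n - r)" .
  qed
  also have "\<dots> = (n choose r) * n ^ (n - r)"
    by (simp add: \<S>_def n_subsets)
  finally show ?thesis .
qed

text \<open>The Gilbert-Varshamov argument: the balls around the words of a maximal code cover all
  \<open>n ^ n\<close> words. Multiplying by \<open>fact r\<close> turns the binomial coefficient of
  the ball size into at most \<open>n ^ r\<close>.\<close>

lemma exists_code:
  assumes "1 \<le> r" "r \<le> n"
  obtains \<V> where "\<V> \<subseteq> {..<n} \<rightarrow>\<^sub>E {..<n}" "fact r \<le> card \<V>"
    "\<And>f g. f \<in> \<V> \<Longrightarrow> g \<in> \<V> \<Longrightarrow> f \<noteq> g \<Longrightarrow> agreement n f g < r"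
proof -
  let ?F = "{..<n} \<rightarrow>\<^sub>E {..<n}"
  define P where "P \<V> \<longleftrightarrow> \<V> \<subseteq> ?F \<and> (\<forall>f\<in>\<V>. \<forall>g\<in>\<V>. f \<noteq> g \<longrightarrow> agreement n f g < r)" for \<V>
  have finF: "finite ?F" by (intro finite_PiE) auto
  have "Collect P \<subseteq> Pow ?F" unfolding P_def by blast
  then have "finite (Collect P)" by (rule finite_subset) (simp add: finF)
  moreover have "P {}" by (simp add: P_def)
  ultimately obtain \<V> where PV: "P \<V>" and max: "\<And>\<W>. P \<W> \<Longrightarrow> \<V> \<subseteq> \<W> \<Longrightarrow> \<W> = \<V>"
    using finite_has_maximal[of "Collect P"] by (metis empty_iff mem_Collect_eq)
  have VF: "\<V> \<subseteq> ?F" using PV by (simp add: P_def)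
  have sym: "agreement n f g = agreement n g f" for f g
    by (simp add: agreement_def eq_commute)
  have self: "agreement n f f = n" for f by (simp add: agreement_def)
  have "?F \<subseteq> (\<Union>f\<in>\<V>. {g \<in> ?F. r \<le> agreement n f g})"
  proof
    fix g assume g: "g \<in> ?F"
    show "g \<in> (\<Union>f\<in>\<V>. {g \<in> ?F. r \<le> agreement n f g})"
    proof (cases "g \<in> \<V>")
      case True
      moreover have "r \<le> agreement n g g" using self assms by simp
      ultimately show ?thesis using g by blast
    next
      case False
      then have "\<not> P (insert g \<V>)" using max[of "insert g \<V>"] by blast
      then obtain f where "f \<in> \<V>" "r \<le> agreement n f g"
        using PV g sym unfolding P_def by (auto simp: not_less)
      then show ?thesis using g by blast
    qed
  qed
  then have "card ?F \<le> card (\<Union>f\<in>\<V>. {g \<in> ?F. r \<le> agreement n f g})"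
    using finite_subset[OF VF finF] finF by (intro card_mono finite_UN_I) auto
  also have "\<dots> \<le> (\<Sum>f\<in>\<V>. card {g \<in> ?F. r \<le> agreement n f g})"
    by (rule card_UN_le[OF finite_subset[OF VF finF]])
  also have "\<dots> \<le> (\<Sum>f\<in>\<V>. (n choose r) * n ^ (n - r))"
    using VF assms by (intro sum_mono card_agreement_ball) auto
  finally have "n ^ n \<le> card \<V> * ((n choose r) * n ^ (n - r))" by (simp add: card_PiE)
  then have "n ^ n * fact r \<le> card \<V> * (((n choose r) * fact r) * n ^ (n - r))"
    by (metis (no_types, lifting) mult.assoc mult.commute mult_le_mono1)
  also have "\<dots> \<le> card \<V> * (n ^ r * n ^ (n - r))"
    by (intro mult_le_mono order_refl binomial_fact_pow)
  also have "n ^ r * n ^ (n - r) = n ^ n" using assms by (simp flip: power_add)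
  finally have "fact r \<le> card \<V>" using assms by (simp add: mult.commute)
  then show thesis
    by (rule that[OF VF]) (use PV in \<open>simp add: P_def\<close>)
qed

text \<open>The normalized indicator of the graph of \<open>f\<close> in an \<open>n\<close> by
  \<open>n\<close> grid, with cell \<open>(a, b)\<close> stored at coordinate
  \<open>a * n + b\<close>. Agreements of words become common cells of graphs.\<close>

definition graph_vector :: "nat \<Rightarrow> nat \<Rightarrow> (nat \<Rightarrow> nat) \<Rightarrow> point" where
  "graph_vector d n f = (\<lambda>i\<in>{..<d}. if i < n * n \<and> i mod n = f (i div n) then 1 / sqrt n else 0)"

lemma graph_vector_inner:
  assumes n: "n \<ge> 1" "n * n \<le> d" and f: "f \<in> {..<n} \<rightarrow>\<^sub>E {..<n}"
  shows "(\<Sum>i<d. graph_vector d n f i * graph_vector d n g i) = agreement n f g / n"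
proof -
  let ?X = "{i. i < n * n \<and> i mod n = f (i div n) \<and> i mod n = g (i div n)}"
  have fn: "f a < n" if "a < n" for a using f that by auto
  have "bij_betw (\<lambda>a. a * n + f a) {a \<in> {..<n}. f a = g a} ?X"
  proof (intro bij_betw_byWitness[where f'="\<lambda>i. i div n"] ballI subsetI)
    fix i assume "i \<in> (\<lambda>a. a * n + f a) ` {a \<in> {..<n}. f a = g a}"
    then obtain a where a: "a < n" "f a = g a" "i = a * n + f a" by blast
    have "i < a * n + n" using a(3) fn[OF a(1)] by linarith
    also have "\<dots> = Suc a * n" by simp
    also have "\<dots> \<le> n * n" using a by (intro mult_le_mono1) simp
    finally have "i < n * n" .
    moreover have "i div n = a" "i mod n = f a" using a(3) fn[OF a(1)] by simp_all
    ultimately show "i \<in> ?X" using a by simp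
  next
    fix a assume "a \<in> {a \<in> {..<n}. f a = g a}"
    then show "(a * n + f a) div n = a" using fn[of a] by simp
  next
    fix i assume "i \<in> ?X"
    then show "i div n * n + f (i div n) = i"
      using div_mult_mod_eq[of i n] by simp
  next
    fix a assume "a \<in> (\<lambda>i. i div n) ` ?X"
    then show "a \<in> {a \<in> {..<n}. f a = g a}"
      by (auto simp: less_mult_imp_div_less)
  qed
  then have card: "card ?X = agreement n f g"
    unfolding agreement_def by (simp add: bij_betw_same_card)
  have "(\<Sum>i<d. graph_vector d n f i * graph_vector d n g i) = (\<Sum>i\<in>?X. 1 / real n)"
    using n by (intro sum.mono_neutral_cong_right) (auto simp: graph_vector_def)
  then show ?thesis by (simp add: card)
qed

lemma exists_spread_vectors:
  assumes r: "r \<ge> 1" "r ^ 4 \<le> d"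
  obtains V where "finite V" "V \<subseteq> unit_sphere d" "fact r \<le> card V"
    "\<And>u v. u \<in> V \<Longrightarrow> v \<in> V \<Longrightarrow> u \<noteq> v \<Longrightarrow> \<bar>\<Sum>i<d. u i * v i\<bar> \<le> 1 / r"
    "\<And>u v. u \<in> V \<Longrightarrow> v \<in> V \<Longrightarrow> u \<noteq> v \<Longrightarrow> (\<Sum>i<d. if u i = 0 then 0 else (v i)\<^sup>2) \<le> 1 / r"
proof -
  \<comment> \<open>Fewer than \<open>r\<close> agreements among \<open>n = r\<^sup>2\<close>
    positions give inner products below \<open>1 / r\<close>, and the grid needs
    \<open>n * n = r ^ 4\<close> coordinates.\<close>
  define n where "n = r ^ 2"
  have n: "n \<ge> 1" "n * n \<le> d" "r \<le> n" and nr: "real n = real r * real r"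
    using r by (auto simp: n_def power2_eq_square power4_eq_xxxx algebra_simps)
  obtain \<V> where V: "\<V> \<subseteq> {..<n} \<rightarrow>\<^sub>E {..<n}" "fact r \<le> card \<V>"
    "\<And>f g. f \<in> \<V> \<Longrightarrow> g \<in> \<V> \<Longrightarrow> f \<noteq> g \<Longrightarrow> agreement n f g < r"
    using exists_code[OF r(1) n(3)] by blast
  have fin: "finite \<V>" using V(1) by (rule finite_subset) (intro finite_PiE; simp)
  let ?v = "graph_vector d n"
  have inner: "(\<Sum>i<d. ?v f i * ?v g i) = agreement n f g / n" if "f \<in> \<V>" for f g
    by (intro graph_vector_inner n subsetD[OF V(1) that])
  have self: "agreement n f f = n" for f by (simp add: agreement_def)
  have unit: "(\<Sum>i<d. (?v f i)\<^sup>2) = 1" if "f \<in> \<V>" for f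
    using inner[OF that, of f] n(1) unfolding power2_eq_square by (simp add: self)
  have small: "agreement n f g / n \<le> 1 / r" if "f \<in> \<V>" "g \<in> \<V>" "f \<noteq> g" for f g
    using V(3)[OF that] r by (simp add: nr field_simps)
  have inj: "inj_on ?v \<V>"
  proof (rule inj_onI, rule ccontr)
    fix f g assume fg: "f \<in> \<V>" "g \<in> \<V>" "?v f = ?v g" "f \<noteq> g"
    then have "agreement n f g = n"
      using inner[OF fg(1), of g] inner[OF fg(1), of f] n by (simp add: self)
    with V(3)[of f g] fg n show False by simp
  qed
  show thesis
  proof (rule that[of "?v ` \<V>"])
    show "?v ` \<V> \<subseteq> unit_sphere d"
    proof (rule image_subsetI)
      fix f assume "f \<in> \<V>"
      moreover have "?v f \<in> space (Rn d)" by (simp add: Rn_def space_PiM graph_vector_def)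
      ultimately show "?v f \<in> unit_sphere d" using unit by (simp add: unit_sphere_def)
    qed
    show "fact r \<le> card (?v ` \<V>)" using V(2) by (simp add: card_image[OF inj])
    fix u v assume "u \<in> ?v ` \<V>" "v \<in> ?v ` \<V>" "u \<noteq> v"
    then obtain f g where fg: "f \<in> \<V>" "g \<in> \<V>" "f \<noteq> g" "u = ?v f" "v = ?v g" by auto
    then show "\<bar>\<Sum>i<d. u i * v i\<bar> \<le> 1 / r"
      using inner[of f g] small[of f g] by simp
    \<comment> \<open>All non-zero entries are equal, so the mass of \<open>v\<close> on the support
      of \<open>u\<close> is the inner product itself.\<close>
    have "(\<Sum>i<d. if u i = 0 then 0 else (v i)\<^sup>2) = (\<Sum>i<d. u i * v i)"
      unfolding fg by (intro sum.cong) (auto simp: graph_vector_def power2_eq_square)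
    then show "(\<Sum>i<d. if u i = 0 then 0 else (v i)\<^sup>2) \<le> 1 / r"
      using fg inner[of f g] small[of f g] by simp
  qed (use fin in auto)
qed


section \<open>The lower bounds\<close>

lemma sum_squares_unit_sphere:
  assumes "v \<in> unit_sphere d"
  shows "(\<Sum>i<d. (v i)\<^sup>2) = 1"
  using assms by (simp add: unit_sphere_def)

lemma halfspace_in_hypotheses: "(\<lambda>x. sign_pm (lin d v x)) \<in> hypotheses d"
  unfolding hypotheses_def sign_pm_def
  by (intro measurable_If measurable_const) (auto simp: labels_def)

text \<open>The competitor is the halfspace with normal vector \<open>s * v\<close>, which follows
  the sign of the bias; its correlation with the bias does not depend on \<open>s\<close>.\<close>

lemma opt_err_ridge:
  assumes v: "v \<in> unit_sphere d" and s: "\<bar>s\<bar> = 1"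
    and [measurable]: "g \<in> borel_measurable borel" and g: "\<And>t. \<bar>g t\<bar> \<le> 1"
  shows "opt_err (halfspaces d) (labelled d (\<lambda>x. s * g (lin d v x)))
    \<le> 1/2 - (\<integral>z. g z * sign_pm z \<partial>std_normal_distribution) / 2"
proof -
  let ?D = "labelled d (\<lambda>x. s * g (lin d v x))"
  define v' where "v' = (\<lambda>i\<in>{..<d}. s * v i)"
  define h where "h x = sign_pm (lin d v' x)" for x
  have ss: "s * s = 1" using s by (auto simp: abs_if split: if_splits)
  have lin': "lin d v' x = s * lin d v x" for x
    unfolding lin_def v'_def sum_distrib_left by (intro sum.cong) (auto simp: mult.assoc)
  have "(\<Sum>i<d. (v' i)\<^sup>2) = (\<Sum>i<d. (s * s) * (v i)\<^sup>2)"
    unfolding v'_def by (intro sum.cong) (auto simp: power2_eq_square)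
  then have "v' \<in> unit_sphere d"
    using v by (simp add: unit_sphere_def v'_def Rn_def space_PiM ss)
  then have "h \<in> halfspaces d" unfolding halfspaces_def h_def[abs_def] lin_def by blast
  moreover have "bdd_below (err ?D ` halfspaces d)"
    by (rule bdd_belowI[of _ 0]) (auto simp: err_def)
  ultimately have "opt_err (halfspaces d) ?D \<le> err ?D h"
    unfolding opt_err_def by (rule cINF_lower[rotated])
  also have "\<dots> = 1/2 - (\<integral>x. h x * (s * g (lin d v x)) \<partial>std_gaussian d) / 2"
  proof (rule err_labelled)
    show "\<bar>s * g (lin d v x)\<bar> \<le> 1" for x using g s by (simp add: abs_mult)
    show "h \<in> hypotheses d" unfolding h_def[abs_def] by (rule halfspace_in_hypotheses)
  qed measurable
  also have "(\<integral>x. h x * (s * g (lin d v x)) \<partial>std_gaussian d)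
      = (\<integral>z. sign_pm (s * z) * (s * g z) \<partial>std_normal_distribution)"
    using integral_lin[of v d 1 "\<lambda>z. sign_pm (s * z) * (s * g z)"] sum_squares_unit_sphere[OF v]
    by (simp add: h_def lin')
  also have "\<dots> = (\<integral>z. g z * sign_pm z \<partial>std_normal_distribution)"
  \<comment> \<open>Equality may fail at 0, where \<open>sign_pm\<close> is not odd.\<close>
  proof (rule integral_cong_AE)
    have "AE z in lborel. z \<noteq> (0::real)" by (rule AE_lborel_singleton)
    then have "AE z in std_normal_distribution. z \<noteq> 0"
      by (subst AE_density) auto
    then show "AE z in std_normal_distribution. sign_pm (s * z) * (s * g z) = g z * sign_pm z"
    proof eventually_elim
      case (elim z)
      consider "s = 1" | "s = -1" using s by (auto simp: abs_if split: if_splits)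
      then show ?case using elim by cases (auto simp: sign_pm_def)
    qed
  qed measurable
  finally show ?thesis .
qed

locale hard_ridges =
  fixes d :: nat and V :: "point set" and g :: "real \<Rightarrow> real" and \<tau> :: real
  assumes finite_V: "finite V" and V: "V \<subseteq> unit_sphere d"
    and g_measurable [measurable]: "g \<in> borel_measurable borel"
    and g_bounded: "\<And>t. \<bar>g t\<bar> \<le> 1"
    and correlation: "\<And>u v. u \<in> V \<Longrightarrow> v \<in> V \<Longrightarrow> u \<noteq> v \<Longrightarrow>
      2 * \<bar>\<integral>x. g (lin d u x) * g (lin d v x) \<partial>std_gaussian d\<bar> \<le> \<tau>\<^sup>2"
    and tau_pos: "\<tau> > 0"

sublocale hard_ridges \<subseteq> hard_family d V "\<lambda>v x. g (lin d v x)" \<tau>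
  by unfold_locales (use finite_V g_bounded correlation tau_pos in auto)

context hard_ridges
begin

text \<open>Half of the correlation \<open>6 * \<epsilon>\<close> is the required advantage
  \<open>\<epsilon> + 2 * \<tau>\<close> for \<open>\<tau> = \<epsilon>\<close>.\<close>

lemma ridge_in_gaussian_class:
  assumes "6 * \<epsilon> \<le> (\<integral>z. g z * sign_pm z \<partial>std_normal_distribution)" "v \<in> V"
  shows "labelled d (\<lambda>x. g (lin d v x)) \<in> gaussian_class d \<epsilon> \<epsilon>"
proof -
  have m: "(\<lambda>x. g (lin d v x)) \<in> borel_measurable (Rn d)" by measurable
  have "opt_err (halfspaces d) (labelled d (\<lambda>x. g (lin d v x))) \<le> 1/2 - \<epsilon> - 2 * \<epsilon>"
    using opt_err_ridge[of v d 1 g] assms V g_bounded by auto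
  then show ?thesis
    using labelled_in_distributions[OF m g_bounded] distr_fst_labelled[OF m g_bounded]
    by (simp add: gaussian_class_def)
qed

lemma learner_lower_bound_ridge:
  assumes "2 * \<epsilon> < (\<integral>z. g z * sign_pm z \<partial>std_normal_distribution)"
    and "sq_algorithm d M L" "makes_at_most d (distributions d) \<tau> M L m"
    and "testable_learner d (halfspaces d) (rcn_half d) \<epsilon> \<delta> \<tau> M L" "\<delta> \<le> 1/6"
  shows "card V * \<tau>\<^sup>2 \<le> 6 * real m"
proof (rule learner_lower_bound[OF assms(2-5)])
  fix v s assume "v \<in> V" "\<bar>s :: real\<bar> = 1"
  then have "opt_err (halfspaces d) (labelled d (\<lambda>x. s * g (lin d v x)))
    \<le> 1/2 - (\<integral>z. g z * sign_pm z \<partial>std_normal_distribution) / 2"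
    using V g_bounded by (intro opt_err_ridge) auto
  then show "opt_err (halfspaces d) (labelled d (\<lambda>x. s * g (lin d v x))) + \<epsilon> < 1/2"
    using assms(1) by linarith
qed

end

section \<open>Choice of parameters\<close>

lemma two_power_le_fact: "2 ^ (r - 1) \<le> (fact r :: nat)"
proof (induction r)
  case (Suc r)
  show ?case
  proof (cases r)
    case (Suc k)
    then have "2 ^ (Suc r - 1) = 2 * 2 ^ (r - 1)" by simp
    also have "\<dots> \<le> Suc r * fact r" using Suc by (intro mult_le_mono Suc.IH) auto
    finally show ?thesis by simp
  qed simp
qed simp

text \<open>The second condition lets the integer part of \<open>x powr (1/4)\<close> exceed
  \<open>x powr (1/8)\<close>; the third absorbs constant factors into powers of the dimension. The
  last compares the size of the family with the loss from the tolerance: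
  \<open>x powr (x powr (1/8))\<close> is negligible against
  \<open>2 powr (x powr (1/4))\<close>.\<close>

lemma eventually_dimension_large:
  "eventually (\<lambda>x::real. x \<ge> 1 \<and> x powr (1/4) - 1 \<ge> x powr (1/8) \<and> x powr (3/128) \<ge> 6 \<and>
     2 powr (x powr (1/8)) \<le> 2 powr (x powr (1/4) - 2) * x powr (- (x powr (1/8))) / 6) at_top"
proof (intro eventually_conj)
  show "eventually (\<lambda>x::real. 2 powr (x powr (1/8)) \<le> 2 powr (x powr (1/4) - 2) * x powr (- (x powr (1/8))) / 6) at_top"
    by real_asymp
qed real_asymp+

lemma hard_ridges_exist:
  fixes d :: nat and \<epsilon> \<tau> :: real
  assumes d: "real d \<ge> 1" "real d powr (1/4) - 1 \<ge> real d powr (1/8)" "real d powr (3/128) \<ge> 6"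
    and \<epsilon>: "0 < \<epsilon>" "\<epsilon> < 1/2" and \<tau>: "0 < \<tau>" "real d powr (- (1 / 14745600 / \<epsilon>\<^sup>2)) < \<tau>"
  obtains V g where "hard_ridges d V g \<tau>" "2 powr (real d powr (1/4) - 2) \<le> card V"
    "2 * \<epsilon> < (\<integral>z. g z * sign_pm z \<partial>std_normal_distribution)"
    "\<epsilon> \<le> 1/6 \<Longrightarrow> 6 * \<epsilon> \<le> (\<integral>z. g z * sign_pm z \<partial>std_normal_distribution)"
proof -
  define r where "r = nat \<lfloor>real d powr (1/4)\<rfloor>"
  have r_gt: "real d powr (1/4) - 1 < real r" unfolding r_def by linarith
  have r_ge: "real d powr (1/8) \<le> real r" using r_gt d(2) by linarith
  have d1: "1 \<le> real d powr (1/8)" using d(1) by (rule ge_one_powr_ge_zero) simp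
  have r1: "1 \<le> r" using r_ge d1 by linarith
  have r_le: "real r \<le> real d powr (1/4)" unfolding r_def using powr_ge_zero[of "real d" "1/4"] by linarith
  have "real r ^ 4 \<le> (real d powr (1/4)) ^ 4" using r_le by (intro power_mono) auto
  also have "\<dots> = real d" using d(1) by (simp add: powr_power)
  finally have r4: "r ^ 4 \<le> d" by (metis of_nat_le_iff of_nat_power)
  obtain V where V: "finite V" "V \<subseteq> unit_sphere d" "fact r \<le> card V"
    "\<And>u v. u \<in> V \<Longrightarrow> v \<in> V \<Longrightarrow> u \<noteq> v \<Longrightarrow> \<bar>\<Sum>i<d. u i * v i\<bar> \<le> 1 / r"
    "\<And>u v. u \<in> V \<Longrightarrow> v \<in> V \<Longrightarrow> u \<noteq> v \<Longrightarrow> (\<Sum>i<d. if u i = 0 then 0 else (v i)\<^sup>2) \<le> 1 / r"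
    by (rule exists_spread_vectors[OF r1 r4]) (rule that; assumption)
  have card_V: "2 powr (real d powr (1/4) - 2) \<le> card V"
  proof -
    have "2 powr (real d powr (1/4) - 2) \<le> 2 powr (real (r - 1))"
      using r_gt r1 by (intro powr_mono) (auto simp: of_nat_diff)
    also have "\<dots> = real (2 ^ (r - 1))" by (simp add: powr_realpow)
    also have "\<dots> \<le> card V" using two_power_le_fact[of r] V(3) by (meson le_trans of_nat_le_iff)
    finally show ?thesis .
  qed
  have r_inv: "1 / real r \<le> real d powr (- (1/8))"
    using r_ge d1 d(1) by (simp add: powr_minus divide_simps)
  \<comment> \<open>\<open>57600 = 240\<^sup>2\<close>: any \<open>n \<le> X\<close> satisfies
    \<open>sqrt n \<le> 1 / (240 * \<epsilon>)\<close>, which makes the sign correlation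
    \<open>1 / (40 * sqrt n)\<close> at least \<open>6 * \<epsilon>\<close>.\<close>
  define X where "X = 1 / (57600 * \<epsilon>\<^sup>2)"
  have X0: "X \<ge> 0" by (simp add: X_def)
  \<comment> \<open>\<open>14745600 = 256 * 57600\<close>, so squaring the tolerance gives the
    exponent \<open>X / 128\<close>.\<close>
  have "(real d powr (- (1 / 14745600 / \<epsilon>\<^sup>2)))\<^sup>2 \<le> \<tau>\<^sup>2" using \<tau> by (intro power_mono) auto
  then have \<tau>2: "real d powr (- (X / 128)) \<le> \<tau>\<^sup>2"
    using d(1) by (simp add: powr_power X_def)
  show thesis
  \<comment> \<open>The threshold is where \<open>X = 1\<close>. Below it at least one moment can be
    cancelled; above it a fixed negative power of \<open>d\<close> suffices and \<open>sgn\<close>,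
    with sign correlation 1, serves up to \<open>\<epsilon> < 1/2\<close>.\<close>
  proof (cases "\<epsilon> \<le> 1 / 240")
    case True
    define n where "n = nat \<lfloor>X\<rfloor>"
    have "\<epsilon>\<^sup>2 \<le> (1 / 240)\<^sup>2" using True \<epsilon> by (intro power_mono) auto
    then have X1: "1 \<le> X" using \<epsilon> by (simp add: X_def field_simps power2_eq_square)
    then have n1: "1 \<le> n" unfolding n_def by linarith
    have n_le: "real n \<le> X" and n_gt: "X < real n + 1" unfolding n_def using X1 by linarith+
    obtain g :: "real \<Rightarrow> real" where g: "g \<in> borel_measurable borel" "\<And>x. \<bar>g x\<bar> \<le> 1"
      "1 / (40 * sqrt n) \<le> (\<integral>z. g z * sign_pm z \<partial>std_normal_distribution)"
      "\<And>d u v. (\<Sum>i<d. (u i)\<^sup>2) = 1 \<Longrightarrow> (\<Sum>i<d. (v i)\<^sup>2) = 1 \<Longrightarrow> \<bar>\<Sum>i<d. u i * v i\<bar> \<le> 1 \<Longrightarrow>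
        \<bar>\<integral>x. g (lin d u x) * g (lin d v x) \<partial>std_gaussian d\<bar> \<le> \<bar>\<Sum>i<d. u i * v i\<bar> ^ (2 * n + 1)"
      by (rule exists_hard_function[OF n1]) (rule that; assumption)
    have "sqrt n \<le> sqrt ((1 / (240 * \<epsilon>))\<^sup>2)"
      using n_le by (intro real_sqrt_le_mono) (simp add: X_def power_divide power_mult_distrib)
    then have "sqrt n \<le> 1 / (240 * \<epsilon>)" using \<epsilon> by simp
    then have "6 * \<epsilon> \<le> 1 / (40 * sqrt n)" using \<epsilon> n1 by (simp add: field_simps)
    then have \<alpha>: "6 * \<epsilon> \<le> (\<integral>z. g z * sign_pm z \<partial>std_normal_distribution)" using g(3) by linarith
    have "hard_ridges d V g \<tau>"
    proof
      fix u v assume uv: "u \<in> V" "v \<in> V" "u \<noteq> v"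
      have "\<bar>\<Sum>i<d. u i * v i\<bar> \<le> 1" using V(4)[OF uv] r1 by (rule_tac order.trans) auto
      then have "\<bar>\<integral>x. g (lin d u x) * g (lin d v x) \<partial>std_gaussian d\<bar> \<le> \<bar>\<Sum>i<d. u i * v i\<bar> ^ (2 * n + 1)"
        using V(2) uv sum_squares_unit_sphere by (intro g(4)) auto
      also have "\<dots> \<le> (real d powr (- (1/8))) ^ (2 * n + 1)"
        using V(4)[OF uv] r_inv by (intro power_mono) auto
      also have "\<dots> = real d powr (- (real (2 * n + 1) / 8))"
        using d(1) by (subst powr_power) (auto simp: field_simps)
      \<comment> \<open>Rounding down is harmless: \<open>2 * n + 1 \<ge> n + 1 > X\<close>.\<close>
      also have "\<dots> \<le> real d powr (- (X / 8))"
        using n_gt d(1) by (intro powr_mono) auto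
      finally have "2 * \<bar>\<integral>x. g (lin d u x) * g (lin d v x) \<partial>std_gaussian d\<bar> \<le> 2 * real d powr (- (X / 8))"
        by simp
      also have "\<dots> \<le> real d powr (3/128) * real d powr (- (X / 8))"
        using d(3) by (intro mult_right_mono) auto
      also have "\<dots> = real d powr (3/128 - X / 8)" by (simp flip: powr_add)
      also have "\<dots> \<le> real d powr (- (X / 128))"
        using X1 d(1) by (intro powr_mono) auto
      also have "\<dots> \<le> \<tau>\<^sup>2" by (rule \<tau>2)
      finally show "2 * \<bar>\<integral>x. g (lin d u x) * g (lin d v x) \<partial>std_gaussian d\<bar> \<le> \<tau>\<^sup>2" .
    qed (use V g \<tau> in auto)
    from that[OF this card_V] \<alpha> \<epsilon> show thesis by auto
  next
    case False
    then have "(1 / 240)\<^sup>2 \<le> \<epsilon>\<^sup>2" by (intro power_mono) auto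
    then have X1: "X \<le> 1" using \<epsilon> by (simp add: X_def field_simps power2_eq_square)
    have "hard_ridges d V sgn \<tau>"
    proof
      fix u v assume uv: "u \<in> V" "v \<in> V" "u \<noteq> v"
      \<comment> \<open>The width \<open>s\<close> in \<open>sgn_correlation_bound\<close>. The
        overlap is at most \<open>?x ^ 4\<close>, so the correlation is at most
        \<open>2 * ?x + ?x\<^sup>2\<close>, and \<open>d powr (3/128) \<ge> 6\<close> turns
        \<open>6 * ?x\<close> into at most \<open>d powr (- (1/128))\<close>.\<close>
      let ?x = "real d powr (- (1/32))"
      have x1: "?x \<le> 1" using d(1) powr_mono[of "- (1/32)" 0 "real d"] by simp
      have x0: "?x > 0" using d(1) by simp
      have x4: "real d powr (- (1/8)) = ?x ^ 4" using d(1) by (simp add: powr_power)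
      have "6 * ?x \<le> real d powr (3/128) * ?x" using d(3) by (intro mult_right_mono) auto
      also have "\<dots> = real d powr (- (1/128))" by (simp flip: powr_add)
      finally have x6: "6 * ?x \<le> real d powr (- (1/128))" .
      also have "\<dots> \<le> 1" using d(1) powr_mono[of "- (1/128)" 0 "real d"] by simp
      finally have "?x \<le> 1 / 6" by simp
      then have "?x ^ 4 \<le> (1 / 6) ^ 4" by (intro power_mono) auto
      then have half: "?x ^ 4 \<le> 1 / 2" by (simp add: power4_eq_xxxx)
      have "\<bar>\<integral>x. sgn (lin d u x) * sgn (lin d v x) \<partial>std_gaussian d\<bar> \<le> 2 * ?x + ?x ^ 4 / ?x\<^sup>2"
        using V(2) uv sum_squares_unit_sphere V(5)[OF uv] r_inv x0 half unfolding x4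
        by (intro sgn_correlation_bound) auto
      also have "?x ^ 4 / ?x\<^sup>2 = ?x * ?x" using x0 by (simp add: power4_eq_xxxx power2_eq_square)
      also have "\<dots> \<le> ?x * 1" using x0 x1 by (intro mult_left_mono) auto
      finally have "2 * \<bar>\<integral>x. sgn (lin d u x) * sgn (lin d v x) \<partial>std_gaussian d\<bar> \<le> 6 * ?x" by simp
      also note x6
      also have "real d powr (- (1/128)) \<le> real d powr (- (X / 128))"
        using X1 d(1) by (intro powr_mono) auto
      also note \<tau>2
      finally show "2 * \<bar>\<integral>x. sgn (lin d u x) * sgn (lin d v x) \<partial>std_gaussian d\<bar> \<le> \<tau>\<^sup>2" .
    qed (use V \<tau> in \<open>auto simp: abs_sgn_eq\<close>)
    from that[OF this card_V] \<epsilon> show thesis by (auto simp: integral_sgn_sign_pm)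
  qed
qed

text \<open>From \<open>\<epsilon> \<ge> d powr (- (1/16))\<close> it follows that
  \<open>1 / \<epsilon>\<^sup>2 \<le> d powr (1/8)\<close>, so the squared tolerance costs at most a
  factor \<open>d powr (d powr (1/8))\<close> of the size of the family.\<close>

lemma query_count_bound:
  fixes d :: nat and \<epsilon> \<tau> :: real
  assumes d: "real d \<ge> 1"
    "2 powr (real d powr (1/8)) \<le> 2 powr (real d powr (1/4) - 2) * real d powr (- (real d powr (1/8))) / 6"
    and \<epsilon>: "\<epsilon> \<ge> real d powr (- (1/16))" and \<tau>: "real d powr (- (1 / 14745600 / \<epsilon>\<^sup>2)) < \<tau>"
    and card: "2 powr (real d powr (1/4) - 2) \<le> N" and m: "N * \<tau>\<^sup>2 \<le> 6 * m"
  shows "2 powr (real d powr (1/8)) \<le> m"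
proof -
  have "(real d powr (- (1/16)))\<^sup>2 \<le> \<epsilon>\<^sup>2" using \<epsilon> by (intro power_mono) auto
  then have "real d powr (- (1/8)) \<le> \<epsilon>\<^sup>2" using d(1) by (simp add: powr_power)
  moreover have "0 < real d powr (- (1/8))" using d(1) by simp
  ultimately have "1 / \<epsilon>\<^sup>2 \<le> 1 / real d powr (- (1/8))" by (intro divide_left_mono mult_pos_pos) auto
  then have "1 / \<epsilon>\<^sup>2 \<le> real d powr (1/8)" by (simp add: powr_minus_divide)
  moreover have "2 * (1 / 14745600 / \<epsilon>\<^sup>2) = (1 / \<epsilon>\<^sup>2) / 7372800" "0 \<le> 1 / \<epsilon>\<^sup>2" by simp_all
  ultimately have "2 * (1 / 14745600 / \<epsilon>\<^sup>2) \<le> real d powr (1/8)"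
    by linarith
  then have "real d powr (- (real d powr (1/8))) \<le> real d powr (- (2 * (1 / 14745600 / \<epsilon>\<^sup>2)))"
    using d(1) by (intro powr_mono) auto
  also have "\<dots> = (real d powr (- (1 / 14745600 / \<epsilon>\<^sup>2)))\<^sup>2"
    using d(1) by (simp add: powr_power)
  also have "\<dots> \<le> \<tau>\<^sup>2" using \<tau> by (intro power_mono) auto
  finally have "2 powr (real d powr (1/4) - 2) * real d powr (- (real d powr (1/8))) \<le> N * \<tau>\<^sup>2"
    using card by (intro mult_mono) (auto intro: order.trans[OF powr_ge_zero])
  then show ?thesis using d(2) m by linarith
qed

theorem theorem3p6:
  shows "\<exists>c>0. \<exists>C\<^sub>1>0. \<exists>C\<^sub>2>0. \<forall>d::nat. \<forall>\<epsilon>::real. d \<ge> 1 \<longrightarrow> \<epsilon> \<ge> real d powr (- c) \<longrightarrow>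
    (\<epsilon> \<le> 1/6 \<longrightarrow>
      (\<forall>(M :: real measure) (A :: real \<Rightarrow> (query, nat) sq_tree) (\<tau>' :: real) (m :: nat).
         \<tau>' > 0 \<longrightarrow> sq_algorithm d M A \<longrightarrow>
         makes_at_most d (insert (rcn_half d) (gaussian_class d \<epsilon> \<epsilon>)) \<tau>' M A m \<longrightarrow>
         distinguishes d (rcn_half d) (gaussian_class d \<epsilon> \<epsilon>) (1/3) \<tau>' M A \<longrightarrow>
         \<tau>' \<le> real d powr (- (C\<^sub>1 / \<epsilon>\<^sup>2)) \<or> real m \<ge> 2 powr (real d powr C\<^sub>2))) \<and>
    (\<epsilon> < 1/2 \<longrightarrow>
      (\<forall>(M :: real measure) (L :: real \<Rightarrow> (query, verdict) sq_tree) (\<tau>' :: real) (\<delta> :: real) (m :: nat).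
         \<tau>' > 0 \<longrightarrow> \<delta> \<le> 1/6 \<longrightarrow> sq_algorithm d M L \<longrightarrow>
         makes_at_most d (distributions d) \<tau>' M L m \<longrightarrow>
         testable_learner d (halfspaces d) (rcn_half d) \<epsilon> \<delta> \<tau>' M L \<longrightarrow>
         \<tau>' \<le> real d powr (- (C\<^sub>1 / \<epsilon>\<^sup>2)) \<or> real m \<ge> 2 powr (real d powr C\<^sub>2)))"
proof -
  obtain D\<^sub>0 where D0: "\<And>x::real. x \<ge> D\<^sub>0 \<Longrightarrow> x \<ge> 1 \<and> x powr (1/4) - 1 \<ge> x powr (1/8) \<and> x powr (3/128) \<ge> 6 \<and>
     2 powr (x powr (1/8)) \<le> 2 powr (x powr (1/4) - 2) * x powr (- (x powr (1/8))) / 6"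
    using eventually_dimension_large unfolding eventually_at_top_linorder by blast
  define D where "D = max D\<^sub>0 4"
  have D: "D \<ge> 4" "log 2 D > 0" by (auto simp: D_def)
  \<comment> \<open>The bound 1/16 serves \<open>query_count_bound\<close>. The other one gives
    \<open>D powr c \<le> 2\<close>, so \<open>d powr (- c) \<ge> 1/2\<close> in every dimension
    \<open>d \<le> D\<close>.\<close>
  define c where "c = min (1/16) (1 / log 2 D)"
  have c: "c > 0" "c \<le> 1/16" "c \<le> 1 / log 2 D" using D by (auto simp: c_def)
  \<comment> \<open>Only large dimensions admit \<open>\<epsilon> < 1/2\<close> at all.\<close>
  have large: "real d \<ge> D\<^sub>0" "\<epsilon> > 0" "\<epsilon> \<ge> real d powr (- (1/16))"
    if "d \<ge> 1" "\<epsilon> \<ge> real d powr (- c)" "\<epsilon> < 1/2" for d :: nat and \<epsilon> :: real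
  proof -
    show "\<epsilon> > 0" using that(1) by (intro less_le_trans[OF _ that(2)]) simp
    have "real d powr (- (1/16)) \<le> real d powr (- c)" using that(1) c(2) by (intro powr_mono) auto
    then show "\<epsilon> \<ge> real d powr (- (1/16))" using that(2) by linarith
    show "real d \<ge> D\<^sub>0"
    proof (rule ccontr)
      assume "\<not> real d \<ge> D\<^sub>0"
      then have "real d powr c \<le> D powr c" using c by (intro powr_mono2) (auto simp: D_def)
      also have "\<dots> \<le> D powr (1 / log 2 D)" using D c by (intro powr_mono) auto
      also have "\<dots> = 2"
        using D by (simp add: powr_def log_def)
      finally have "1 / 2 \<le> 1 / real d powr c" using that(1) by (intro divide_left_mono) auto
      moreover have "1 / real d powr c \<le> \<epsilon>" using that(2) by (simp add: powr_minus_divide)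
      ultimately show False using that(3) by linarith
    qed
  qed
  have dist: "real m \<ge> 2 powr (real d powr (1/8))"
    if \<tau>_gt: "real d powr (- (1 / 14745600 / \<epsilon>\<^sup>2)) < \<tau>"
      and d: "d \<ge> 1" "\<epsilon> \<ge> real d powr (- c)" and \<epsilon>: "\<epsilon> \<le> 1/6" and \<tau>: "\<tau> > 0"
      and alg: "sq_algorithm d M A"
      "makes_at_most d (insert (rcn_half d) (gaussian_class d \<epsilon> \<epsilon>)) \<tau> M A m"
      "distinguishes d (rcn_half d) (gaussian_class d \<epsilon> \<epsilon>) (1/3) \<tau> M A"
    for d \<epsilon> M A \<tau> m
  proof -
    have \<epsilon>2: "\<epsilon> < 1/2" using \<epsilon> by simp
    note L = large[OF d \<epsilon>2]
    note D' = D0[OF L(1)]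
    obtain V g where H: "hard_ridges d V g \<tau>" "2 powr (real d powr (1/4) - 2) \<le> card V"
      "\<epsilon> \<le> 1/6 \<Longrightarrow> 6 * \<epsilon> \<le> (\<integral>z. g z * sign_pm z \<partial>std_normal_distribution)"
      using hard_ridges_exist[of d \<epsilon> \<tau> thesis] D' L(2) \<epsilon>2 \<tau> \<tau>_gt by blast
    interpret hard_ridges d V g \<tau> by (rule H(1))
    have "card V * \<tau>\<^sup>2 \<le> 6 * real m"
      by (rule distinguisher_lower_bound[OF alg]) (rule ridge_in_gaussian_class[OF H(3)[OF \<epsilon>]])
    then show ?thesis
      using query_count_bound[of d \<epsilon> \<tau> "card V" m] D' L(3) \<tau>_gt H(2) by blast
  qed
  have learn: "real m \<ge> 2 powr (real d powr (1/8))"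
    if \<tau>_gt: "real d powr (- (1 / 14745600 / \<epsilon>\<^sup>2)) < \<tau>"
      and d: "d \<ge> 1" "\<epsilon> \<ge> real d powr (- c)" and \<epsilon>: "\<epsilon> < 1/2" and \<tau>: "\<tau> > 0"
      and \<delta>: "\<delta> \<le> 1/6"
      and alg: "sq_algorithm d M L" "makes_at_most d (distributions d) \<tau> M L m"
      "testable_learner d (halfspaces d) (rcn_half d) \<epsilon> \<delta> \<tau> M L"
    for d \<epsilon> M L \<tau> \<delta> m
  proof -
    note L = large[OF d \<epsilon>]
    note D' = D0[OF L(1)]
    obtain V g where H: "hard_ridges d V g \<tau>" "2 powr (real d powr (1/4) - 2) \<le> card V"
      "2 * \<epsilon> < (\<integral>z. g z * sign_pm z \<partial>std_normal_distribution)"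
      using hard_ridges_exist[of d \<epsilon> \<tau> thesis] D' L(2) \<epsilon> \<tau> \<tau>_gt by blast
    interpret hard_ridges d V g \<tau> by (rule H(1))
    have "card V * \<tau>\<^sup>2 \<le> 6 * real m"
      by (rule learner_lower_bound_ridge[OF H(3) alg \<delta>])
    then show ?thesis
      using query_count_bound[of d \<epsilon> \<tau> "card V" m] D' L(3) \<tau>_gt H(2) by blast
  qed
  show ?thesis
    by (rule exI[of _ c], rule conjI[OF c(1)], rule exI[of _ "1 / 14745600"], rule conjI, simp,
      rule exI[of _ "1/8"], rule conjI, simp, intro allI impI conjI)
      (use dist learn in \<open>metis not_le\<close>)+
qed

end
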